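(* Let $f:\mathbb R^n\to\mathbb R$ and $g:\mathbb R^m\to\mathbb R$ be convex and differentiable, with $\nabla f$ and $\nabla g$ Lipschitz continuous with constants $L_f>0$ and $L_g>0$, respectively, let $K\in\mathbb R^{m\times n}$, and assume that the saddle point set $\mathcal S$ of $\mathcal L(x,y)=f(x)+\langle Kx,y\rangle-g(y)$ is nonempty. Let $0<r\le\frac1{L_f}$, $0<s\le\frac1{L_g}$, $\rho\in(0,1]$, $\eta\in[\rho,1]$, and let $\{t_k\}_{k\ge1}$ be a nondecreasing real sequence with $t_1=1$, $t_k\to+\infty$ and $t_{k+1}^2\le t_k^2+\rho t_{k+1}$ for all $k\ge1$. Let $\{z_k\}_{k\ge0}=\{(x_k,y_k)\}_{k\ge0}$ be the sequence generated, with these parameters, by the fast primal-dual algorithm described in the context. Then, as $k\to+\infty$: (i) For every $(x^*,y^* )\in\mathcal S$, $$\mathcal L(x_k,y^* )-\mathcal L(x^*,y_k)=\mathcal O\left(\frac1{t_k^2}\right),\qquad \|(x_k,y_k)-(x_{k-1},y_{k-1})\|=\mathcal O\left(\frac1{t_k}\right).$$ (ii) There exists $(x^*,y^* )\in\mathcal S$ such that $(x_k,y_k)\to(x^*,y^* )$. (iii) If $\rho<\eta<1$, then, with $(x^*,y^* )$ the limit in (ii): (a) $\mathcal L(x_k,y^* )-\mathcal L(x^*,y_k)=o\left(\frac1{t_k^2}\right)$ and $\|(x_k,y_k)-(x_{k-1},y_{k-1})\|=o\left(\frac1{t_k}\right)$; (b) $$\left\|\begin{pmatrix}\nabla f(x_k)+K^\top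 y_k\\ \nabla g(y_k)-Kx_k\end{pmatrix}\right\|=o\left(\frac1{t_k}\right).$$
   Context: A point $(x^*,y^* )\in\mathbb R^n\times\mathbb R^m$ is a saddle point of $\mathcal L$ if $\mathcal L(x^*,y)\le\mathcal L(x^*,y^* )\le\mathcal L(x,y^* )$ for all $(x,y)\in\mathbb R^n\times\mathbb R^m$; $\mathcal S$ denotes the set of all saddle points. Norms and inner products are Euclidean. Fast primal-dual algorithm: choose $x_0=x_1\in\mathbb R^n$, $y_0=y_1\in\mathbb R^m$ arbitrarily. Put $a_k:=\frac{t_{k+1}-\eta}{\eta}$ and $c_k:=1+a_k$. For $k=1,2,\dots$ compute $$\bar x_k=x_k+\frac{t_k-1}{t_{k+1}}(x_k-x_{k-1}),\qquad \bar y_k=y_k+\frac{t_k-1}{t_{k+1}}(y_k-y_{k-1}),$$ $$x_{k+1}=\arg\min_{x\in\mathbb R^n}\Bigl\{\tfrac1{2r}\|x-\bar x_k\|^2+\langle\nabla f(\bar x_k),x\rangle+\langle Kx,\,c_k(\bar y_k-s\nabla g(\bar y_k))-a_ky_k\rangle+\tfrac s2\|c_kKx-a_kKx_k\|^2\Bigr\},$$ $$y_{k+1}=\bar y_k-s\nabla g(\bar y_k)+sK(c_kx_{k+1}-a_kx_k).$$ Equivalently, $(x_{k+1},y_{k+1})$ is the solution of the coupled system $$x_{k+1}-\bar x_k+r\bigl(\nabla f(\bar x_k)+K^\top(y_{k+1}+a_k(y_{k+1}-y_k))\bigr)=0,$$ $$y_{k+1}-\bar y_k+s\bigl(\nabla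 g(\bar y_k)-K(x_{k+1}+a_k(x_{k+1}-x_k))\bigr)=0.$$ *)

theory Defs
  imports "HOL-Analysis.Analysis" "HOL-Library.Landau_Symbols"
begin

text \<open>Meaningful at points where \<open>f\<close> is differentiable; there the vector is unique.\<close>

definition gradient :: "('a::real_inner \<Rightarrow> real) \<Rightarrow> 'a \<Rightarrow> 'a" where
  "gradient f x = (THE D. GDERIV f x :> D)"

definition lagrangian ::
    "(real^'n \<Rightarrow> real) \<Rightarrow> (real^'m \<Rightarrow> real) \<Rightarrow> real^'n^'m \<Rightarrow> real^'n \<Rightarrow> real^'m \<Rightarrow> real" where
  "lagrangian f g K x y = f x + inner (K *v x) y - g y"

definition saddle_points :: "('a \<Rightarrow> 'b \<Rightarrow> real) \<Rightarrow> ('a \<times> 'b) set" where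
  "saddle_points L =
     {(xs, ys). \<forall>x y. L xs y \<le> L xs ys \<and> L xs ys \<le> L x ys}"

definition extrapolate :: "(nat \<Rightarrow> real) \<Rightarrow> (nat \<Rightarrow> 'a::real_vector) \<Rightarrow> nat \<Rightarrow> 'a" where
  "extrapolate t x k = x k + ((t k - 1) / t (k + 1)) *\<^sub>R (x k - x (k - 1))"

definition coeff_a :: "real \<Rightarrow> (nat \<Rightarrow> real) \<Rightarrow> nat \<Rightarrow> real" where
  "coeff_a \<eta> t k = (t (k + 1) - \<eta>) / \<eta>"

definition coeff_c :: "real \<Rightarrow> (nat \<Rightarrow> real) \<Rightarrow> nat \<Rightarrow> real" where
  "coeff_c \<eta> t k = 1 + coeff_a \<eta> t k"

text \<open>
  The objective minimised over \<open>u\<close> in step \<open>k\<close>, where \<open>xk\<close>, \<open>yk\<close> are the current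
  iterates, \<open>xb\<close>, \<open>yb\<close> the extrapolated points, and \<open>a\<close>, \<open>c\<close> the step coefficients.
\<close>

definition primal_objective ::
    "(real^'n \<Rightarrow> real) \<Rightarrow> (real^'m \<Rightarrow> real) \<Rightarrow> real^'n^'m \<Rightarrow> real \<Rightarrow> real \<Rightarrow> real \<Rightarrow> real \<Rightarrow>
     real^'n \<Rightarrow> real^'m \<Rightarrow> real^'n \<Rightarrow> real^'m \<Rightarrow> real^'n \<Rightarrow> real" where
  "primal_objective f g K r s a c xk yk xb yb u =
     1 / (2 * r) * (norm (u - xb))\<^sup>2
     + inner (gradient f xb) u
     + inner (K *v u) (c *\<^sub>R (yb - s *\<^sub>R gradient g yb) - a *\<^sub>R yk)
     + s / 2 * (norm (c *\<^sub>R (K *v u) - a *\<^sub>R (K *v xk)))\<^sup>2"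

definition fast_primal_dual ::
    "(real^'n \<Rightarrow> real) \<Rightarrow> (real^'m \<Rightarrow> real) \<Rightarrow> real^'n^'m \<Rightarrow> real \<Rightarrow> real \<Rightarrow> real \<Rightarrow>
     (nat \<Rightarrow> real) \<Rightarrow> (nat \<Rightarrow> real^'n) \<Rightarrow> (nat \<Rightarrow> real^'m) \<Rightarrow> bool" where
  "fast_primal_dual f g K r s \<eta> t x y \<longleftrightarrow>
     x 0 = x 1 \<and> y 0 = y 1 \<and>
     (\<forall>k\<ge>1.
        let a = coeff_a \<eta> t k; c = coeff_c \<eta> t k;
            xb = extrapolate t x k; yb = extrapolate t y k
        in is_arg_min (primal_objective f g K r s a c (x k) (y k) xb yb) (\<lambda>_. True) (x (k + 1)) \<and>
           y (k + 1) = yb - s *\<^sub>R gradient g yb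
                       + s *\<^sub>R (K *v (c *\<^sub>R x (k + 1) - a *\<^sub>R x k)))"

end

theory Submission
  imports Defs
begin

text \<open>
In the product space, write \<open>z = (x, y)\<close>, let \<open>F\<close> be the sum of \<open>f\<close> and \<open>g\<close> with gradient \<open>G\<close>, and let
\<open>B\<close> be the skew operator \<open>(x, y) \<mapsto> (K\<^sup>T y, - K x)\<close>. Saddle points are the zeros of \<open>G + B\<close>, the
primal-dual gap at a saddle point \<open>w\<close> is the Bregman distance \<open>D\<close> of \<open>F\<close> to \<open>w\<close>
(\<open>lagrangian_gap_eq_bregman\<close>), and after rescaling the coordinates by the square roots of the step sizes
the algorithm reads
\<open>z\<^sub>k\<^sub>+\<^sub>1 = b\<^sub>k - G b\<^sub>k - B v\<^sub>k\<^sub>+\<^sub>1\<close>, where \<open>b\<^sub>k\<close> is the extrapolated point and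
\<open>v\<^sub>k = z\<^sub>k\<^sub>-\<^sub>1 + (t\<^sub>k / \<eta>) (z\<^sub>k - z\<^sub>k\<^sub>-\<^sub>1)\<close>.

The proof rests on the energy
\<open>t\<^sub>k\<^sup>2 D(z\<^sub>k, w) + |\<eta> (v\<^sub>k - w)|\<^sup>2 / 2 + \<eta> (1 - \<eta>) |z\<^sub>k\<^sub>-\<^sub>1 - w|\<^sup>2 / 2\<close>.
Since \<open>B\<close> is applied at \<open>v\<^sub>k\<^sub>+\<^sub>1\<close>, the vector that appears in the energy, skewness removes it from the
energy balance and the energy decreases (\<open>energy_decrease\<close>). The big-O rates follow at once
(\<open>iterate_bounds\<close>).

For convergence of the iterates, the gradient and the Bregman distance are the same for all saddle points
(\<open>zeros_eq_gradient_and_bregman\<close>), so the difference of the energies at two saddle points \<open>w\<close> and \<open>w'\<close>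
is affine in the iterates: with \<open>h\<^sub>k\<close> the scalar product of \<open>z\<^sub>k\<close> and \<open>w' - w\<close>, the sequence
\<open>h\<^sub>k\<^sub>-\<^sub>1 + t\<^sub>k (h\<^sub>k - h\<^sub>k\<^sub>-\<^sub>1)\<close> converges. As \<open>t\<^sub>k \<le> k\<close>, the weights \<open>1 / t\<^sub>k\<close> have infinite
sum, and an averaging argument yields convergence of \<open>h\<^sub>k\<close> itself (\<open>projection_convergent\<close>). The same
averaging argument shows that \<open>B z\<^sub>k\<close> converges to \<open>B w\<close>, so all cluster points are saddle points, and
there can be only one (\<open>iterates_converge\<close>).

For \<open>\<rho> < \<eta> < 1\<close> the energy decrease is strict enough for \<open>t\<^sub>k (D + |z\<^sub>k - z\<^sub>k\<^sub>-\<^sub>1|\<^sup>2)\<close> to be summable.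
Together with convergence of the energy and divergence of the sum of \<open>1 / t\<^sub>k\<close> this gives the little-o rates
(\<open>fast_rates\<close>).
\<close>

section \<open>Scalar sequences with divergent step sizes\<close>

lemma dissipated_energy:
  fixes E \<delta> :: "nat \<Rightarrow> real"
  assumes E_nonneg: "\<And>n. 0 \<le> E n" and \<delta>_nonneg: "\<And>n. 0 \<le> \<delta> n"
    and step: "\<And>n. E (Suc n) + \<delta> n \<le> E n"
  shows "convergent E" and "summable \<delta>"
proof -
  have "decseq E"
    by (rule decseq_SucI) (use \<delta>_nonneg step in \<open>smt (verit)\<close>)
  then show "convergent E"
    using decseq_convergent[of E 0] E_nonneg unfolding convergent_def by metis
  have "E n + (\<Sum>i<n. \<delta> i) \<le> E 0" for n
  proof (induction n)
    case (Suc n)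
    then show ?case using step[of n] by simp
  qed simp
  then have "(\<Sum>i<n. \<delta> i) \<le> E 0" for n
    using E_nonneg[of n] by (smt (verit))
  then show "summable \<delta>"
    by (intro summableI_nonneg_bounded[of \<delta> "E 0"] \<delta>_nonneg)
qed

text \<open>
If the limit were positive, the summable series \<open>\<Sum> \<theta> n * a n\<close> would eventually dominate a positive
multiple of the divergent series of weights. This is how a summability bound turns a
\<open>O(1/t\<^sup>2)\<close> estimate into a \<open>o(1/t\<^sup>2)\<close> one.
\<close>

lemma nonsummable_weights_limit_zero:
  fixes \<theta> a :: "nat \<Rightarrow> real"
  assumes \<theta>_nonneg: "\<And>n. 0 \<le> \<theta> n" and \<theta>_div: "\<not> summable \<theta>"
    and a_nonneg: "\<And>n. 0 \<le> a n" and sum: "summable (\<lambda>n. \<theta> n * a n)"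
    and lim: "a \<longlonglongrightarrow> l"
  shows "l = 0"
proof (rule ccontr)
  assume "l \<noteq> 0"
  moreover have "0 \<le> l"
    using LIMSEQ_le_const[OF lim, of 0] a_nonneg by blast
  ultimately have "0 < l" by simp
  then have "\<forall>\<^sub>F n in sequentially. l / 2 < a n"
    using order_tendstoD(1)[OF lim, of "l/2"] by simp
  then have "\<forall>\<^sub>F n in sequentially. norm (\<theta> n) \<le> 2 / l * (\<theta> n * a n)"
  proof eventually_elim
    case (elim n)
    then have "\<theta> n * (l / 2) \<le> \<theta> n * a n"
      using \<theta>_nonneg[of n] by (intro mult_left_mono) auto
    then show ?case using \<open>0 < l\<close> \<theta>_nonneg[of n] by (simp add: field_simps)
  qed
  then have "summable \<theta>"
    by (rule summable_comparison_test_ev) (intro summable_mult sum)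
  with \<theta>_div show False by contradiction
qed

text \<open>
Once \<open>e n < \<epsilon>\<close>, the excess \<open>max (p n - \<epsilon>) 0\<close> contracts by the factor \<open>1 - \<theta> n\<close>. It is
therefore an energy dissipating \<open>\<theta> n\<close> times itself, and divergence of the weights drives it to zero.
\<close>

lemma averaging_recursion_tendsto_zero:
  fixes p e \<theta> :: "nat \<Rightarrow> real"
  assumes \<theta>: "\<And>n. 0 \<le> \<theta> n" "\<And>n. \<theta> n \<le> 1" and \<theta>_div: "\<not> summable \<theta>"
    and p_nonneg: "\<And>n. 0 \<le> p n"
    and rec: "\<And>n. p (Suc n) \<le> (1 - \<theta> n) * p n + \<theta> n * e n"
    and e: "e \<longlonglongrightarrow> 0"
  shows "p \<longlonglongrightarrow> 0"
proof (rule LIMSEQ_I)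
  fix \<epsilon>' :: real assume "0 < \<epsilon>'"
  define \<epsilon> where "\<epsilon> = \<epsilon>' / 2"
  have "0 < \<epsilon>" using \<open>0 < \<epsilon>'\<close> by (simp add: \<epsilon>_def)
  then obtain N where N: "\<And>n. n \<ge> N \<Longrightarrow> e n < \<epsilon>"
    using order_tendstoD(2)[OF e] by (auto simp: eventually_sequentially)
  define m where "m n = max (p (n + N) - \<epsilon>) 0" for n
  have m_nonneg: "0 \<le> m n" for n by (simp add: m_def)
  have m_step: "m (Suc n) + \<theta> (n + N) * m n \<le> m n" for n
  proof -
    have "p (Suc n + N) - \<epsilon> \<le> (1 - \<theta> (n + N)) * (p (n + N) - \<epsilon>) + \<theta> (n + N) * (e (n + N) - \<epsilon>)"
      using rec[of "n + N"] by (simp add: algebra_simps)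
    also have "\<dots> \<le> (1 - \<theta> (n + N)) * (p (n + N) - \<epsilon>)"
      using \<theta>(1)[of "n + N"] N[of "n + N"] by (simp add: mult_nonneg_nonpos)
    also have "\<dots> \<le> (1 - \<theta> (n + N)) * m n"
      using \<theta>(2)[of "n + N"] by (intro mult_left_mono) (auto simp: m_def)
    finally have "p (Suc n + N) - \<epsilon> \<le> (1 - \<theta> (n + N)) * m n" .
    moreover have "0 \<le> (1 - \<theta> (n + N)) * m n"
      using \<theta>(2)[of "n + N"] m_nonneg[of n] by simp
    ultimately have "m (Suc n) \<le> (1 - \<theta> (n + N)) * m n" by (simp add: m_def)
    then show ?thesis by (simp add: algebra_simps)
  qed
  have "0 \<le> \<theta> (n + N) * m n" for n using \<theta>(1) m_nonneg by simp
  note diss = dissipated_energy[of m "\<lambda>n. \<theta> (n + N) * m n", OF m_nonneg this m_step]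
  obtain l where l: "m \<longlonglongrightarrow> l" using diss(1) by (auto simp: convergent_def)
  have "l = 0"
    using nonsummable_weights_limit_zero[of "\<lambda>n. \<theta> (n + N)" m l] \<theta>(1) \<theta>_div m_nonneg diss(2) l
    by (simp add: summable_iff_shift[of \<theta>])
  then have "\<forall>\<^sub>F n in sequentially. m n < \<epsilon>"
    using order_tendstoD(2)[OF l] \<open>0 < \<epsilon>\<close> by simp
  then obtain M where M: "\<And>n. n \<ge> M \<Longrightarrow> m n < \<epsilon>" by (auto simp: eventually_sequentially)
  have "norm (p n - 0) < \<epsilon>'" if "n \<ge> M + N" for n
  proof -
    have "p n - \<epsilon> \<le> m (n - N)" using that by (simp add: m_def)
    also have "\<dots> < \<epsilon>" using M[of "n - N"] that by simp
    finally show ?thesis using p_nonneg[of n] by (simp add: \<epsilon>_def)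
  qed
  then show "\<exists>no. \<forall>n\<ge>no. norm (p n - 0) < \<epsilon>'" by blast
qed

section \<open>Smooth convex functions coupled by a skew operator\<close>

text \<open>
The skew operator \<open>B\<close> stands for the bilinear coupling and \<open>F\<close> for the sum of the two convex
functions. For convex \<open>F\<close>, the second assumption amounts to a gradient with Lipschitz constant 1; the step
sizes have been absorbed by a change of variables.
\<close>

locale smooth_convex_skew =
  fixes F :: "'a::euclidean_space \<Rightarrow> real" and G B :: "'a \<Rightarrow> 'a"
  assumes above_tangent: "F q + G q \<bullet> (p - q) \<le> F p"
    and below_parabola: "F p \<le> F q + G q \<bullet> (p - q) + (norm (p - q))\<^sup>2 / 2"
    and linear_B: "linear B"
    and skew: "B p \<bullet> p = 0"
begin

definition bregman :: "'a \<Rightarrow> 'a \<Rightarrow> real" where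
  "bregman p q = F p - F q - G q \<bullet> (p - q)"

definition zeros :: "'a set" where
  "zeros = {w. G w + B w = 0}"

lemma bregman_nonneg: "0 \<le> bregman p q"
  using above_tangent[of q p] by (simp add: bregman_def)

text \<open>
The Bregman distance is nonnegative everywhere, in particular at the point reached from \<open>p\<close> by one
gradient step on \<open>\<lambda>p. bregman p q\<close>. That step decreases the value by at least half the
squared norm of the gradient \<open>G p - G q\<close>.
\<close>

lemma norm_gradient_diff_le_bregman: "(norm (G p - G q))\<^sup>2 \<le> 2 * bregman p q"
proof -
  define \<delta> where "\<delta> = G p - G q"
  have "0 \<le> bregman (p - \<delta>) q" by (rule bregman_nonneg)
  moreover have "F (p - \<delta>) \<le> F p - G p \<bullet> \<delta> + (norm \<delta>)\<^sup>2 / 2"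
    using below_parabola[of "p - \<delta>" p] by (simp add: inner_simps)
  moreover have "G p \<bullet> \<delta> - G q \<bullet> \<delta> = (norm \<delta>)\<^sup>2"
    by (simp add: \<delta>_def power2_norm_eq_inner inner_simps)
  ultimately show ?thesis
    by (simp add: bregman_def inner_simps flip: \<delta>_def)
qed

lemma gradient_nonexpansive: "norm (G p - G q) \<le> norm (p - q)"
proof -
  have "bregman p q \<le> (norm (p - q))\<^sup>2 / 2"
    using below_parabola[of p q] by (simp add: bregman_def)
  then have "(norm (G p - G q))\<^sup>2 \<le> (norm (p - q))\<^sup>2"
    using norm_gradient_diff_le_bregman[of p q] by linarith
  then show ?thesis by (rule power2_le_imp_le[OF _ norm_ge_zero])
qed

lemma continuous_gradient: "isCont G p"
proof -
  have "1-lipschitz_on UNIV G"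
    using gradient_nonexpansive by (intro lipschitz_onI) (auto simp: dist_norm)
  then show ?thesis
    using lipschitz_on_continuous_on continuous_on_eq_continuous_at[of UNIV G] by blast
qed

lemma B_diff: "B (p - q) = B p - B q" and B_add: "B (p + q) = B p + B q"
  and B_scaleR: "B (c *\<^sub>R p) = c *\<^sub>R B p"
  using linear_B by (auto simp: linear_diff linear_add linear_scale)

lemma continuous_B: "isCont B p"
  using linear_continuous_at linear_B linear_conv_bounded_linear by blast

text \<open>
Skewness makes \<open>(G w - G w') \<bullet> (w - w')\<close> vanish for two zeros, and this is the symmetrised
Bregman distance. Consequently the gradient and the primal-dual gap do not depend on the
saddle point used to define them, which is what makes the difference of two energies affine.
\<close>

lemma zeros_eq_gradient_and_bregman:
  assumes "w \<in> zeros" "w' \<in> zeros"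
  shows "G w = G w'" and "bregman p w = bregman p w'"
proof -
  have "bregman w w' + bregman w' w = (G w - G w') \<bullet> (w - w')"
    by (simp add: bregman_def inner_simps)
  also have "G w - G w' = - B (w - w')"
    using assms by (simp add: zeros_def B_diff algebra_simps add_eq_0_iff)
  also have "- B (w - w') \<bullet> (w - w') = 0"
    using skew[of "w - w'"] by simp
  finally have sum: "bregman w w' + bregman w' w = 0" .
  then have zero: "bregman w w' = 0" "bregman w' w = 0"
    using bregman_nonneg[of w w'] bregman_nonneg[of w' w] by linarith+
  show G: "G w = G w'"
    using norm_gradient_diff_le_bregman[of w w'] zero by simp
  show "bregman p w = bregman p w'"
    using zero G by (simp add: bregman_def inner_simps)
qed

end

section \<open>The energy of the accelerated iteration\<close>

text \<open>
Here \<open>p = z\<^sub>k - w\<close>, \<open>d\<close> is the last increment, \<open>q\<close> the displacement away from the extrapolated point,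
and \<open>u\<close>, \<open>u'\<close> two consecutive momentum vectors. The term in \<open>(norm p)\<^sup>2\<close> on the left is
there to absorb the cross product \<open>p \<bullet> d\<close>, so that only a dissipative multiple of
\<open>(norm d)\<^sup>2\<close> remains.
\<close>

lemma momentum_energy_identity:
  fixes u d q p :: "'a::real_inner" and \<tau> \<tau>' \<eta> :: real
  assumes u: "u = \<eta> *\<^sub>R p + (\<tau> - \<eta>) *\<^sub>R d"
    and u': "u' = u - (1 - \<eta>) *\<^sub>R d - \<tau>' *\<^sub>R q"
  shows "(norm u')\<^sup>2 / 2 + \<eta> * (1 - \<eta>) / 2 * (norm p)\<^sup>2 =
    (norm u)\<^sup>2 / 2 + \<eta> * (1 - \<eta>) / 2 * (norm (p - d))\<^sup>2
      - \<tau>' * (q \<bullet> u') - \<tau>'\<^sup>2 / 2 * (norm q)\<^sup>2 - (1 - \<eta>) * (\<tau> - 1 / 2) * (norm d)\<^sup>2"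
proof -
  have "q \<bullet> d = d \<bullet> q" "q \<bullet> p = p \<bullet> q" "d \<bullet> p = p \<bullet> d" by (simp_all add: inner_commute)
  then show ?thesis
    unfolding u' u power2_norm_eq_inner
    by (simp add: inner_simps power2_eq_square field_simps)
qed

locale fast_skew_gradient = smooth_convex_skew F G B
  for F :: "'a::euclidean_space \<Rightarrow> real" and G B :: "'a \<Rightarrow> 'a" +
  fixes t :: "nat \<Rightarrow> real" and z :: "nat \<Rightarrow> 'a" and \<rho> \<eta> :: real
  assumes \<rho>_pos: "0 < \<rho>" and \<rho>_le_\<eta>: "\<rho> \<le> \<eta>" and \<eta>_le_1: "\<eta> \<le> 1"
    and t_Suc_ge: "\<And>k. 1 \<le> k \<Longrightarrow> t k \<le> t (Suc k)" and t_1: "t 1 = 1"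
    and t_unbounded: "filterlim t at_top sequentially"
    and t_growth: "\<And>k. 1 \<le> k \<Longrightarrow> (t (Suc k))\<^sup>2 \<le> (t k)\<^sup>2 + \<rho> * t (Suc k)"
    and step: "\<And>k. 1 \<le> k \<Longrightarrow> z (Suc k) = extrapolate t z k - G (extrapolate t z k)
                 - B (z k + (t (Suc k) / \<eta>) *\<^sub>R (z (Suc k) - z k))"
begin

text \<open>
\<open>v k\<close> is the extrapolation beyond \<open>z k\<close> at which the iteration evaluates \<open>B\<close>. By
\<open>z_average\<close> below, \<open>z k\<close> is in turn a convex combination of \<open>z (k - 1)\<close> and \<open>v k\<close>.
\<close>

definition v :: "nat \<Rightarrow> 'a" where
  "v k = z (k - 1) + (t k / \<eta>) *\<^sub>R (z k - z (k - 1))"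

definition energy :: "'a \<Rightarrow> nat \<Rightarrow> real" where
  "energy w k = (t k)\<^sup>2 * bregman (z k) w + (norm (\<eta> *\<^sub>R (v k - w)))\<^sup>2 / 2
     + \<eta> * (1 - \<eta>) / 2 * (norm (z (k - 1) - w))\<^sup>2"

lemma \<eta>_pos: "0 < \<eta>" using \<rho>_pos \<rho>_le_\<eta> by simp

lemma t_ge_1: "1 \<le> k \<Longrightarrow> 1 \<le> t k"
  by (induction k rule: dec_induct) (use t_1 t_Suc_ge in force)+

text \<open>
The growth condition bounds the increments of \<open>t\<close>, so \<open>t\<close> grows at most linearly and the weights
\<open>1 / t k\<close> have a divergent sum.
\<close>

lemma t_Suc_le: "1 \<le> k \<Longrightarrow> t (Suc k) \<le> t k + \<rho>"
proof -
  assume k: "1 \<le> k"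
  have "t (Suc k) * (t (Suc k) - \<rho>) \<le> t k * t k"
    using t_growth[OF k] by (simp add: power2_eq_square algebra_simps)
  then show ?thesis
    using t_ge_1[OF k] t_ge_1[of "Suc k"] \<rho>_pos
    by (smt (verit) mult_less_cancel_left_pos mult_strict_mono t_Suc_ge[OF k] mult_le_cancel_left_pos mult_right_mono)
qed

lemma t_le: "1 \<le> k \<Longrightarrow> t k \<le> real k"
proof (induction k rule: dec_induct)
  case (step k)
  then show ?case using t_Suc_le[of k] \<rho>_le_\<eta> \<eta>_le_1 by simp
qed (use t_1 in simp)

lemma not_summable_inverse_t:
  assumes "0 < c"
  shows "\<not> summable (\<lambda>k. c / t k)"
proof
  assume "summable (\<lambda>k. c / t k)"
  then have "summable (\<lambda>k. (1 / c) * (c / t k))" by (rule summable_mult)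
  then have sum: "summable (\<lambda>k. 1 / t k)" using assms by simp
  have "\<forall>\<^sub>F k in sequentially. norm (inverse (real k)) \<le> 1 / t k"
    using eventually_ge_at_top[of 1]
    by eventually_elim (use t_le t_ge_1 in \<open>force simp: field_simps\<close>)
  then have "summable (\<lambda>k. inverse (real k))"
    by (rule summable_comparison_test_ev) (rule sum)
  then show False using not_summable_harmonic[where 'a = real] by contradiction
qed

text \<open>
Convergence of the extrapolated quantities \<open>c k\<close> passes to the averaged ones. With \<open>\<kappa> = \<eta>\<close> it applies to \<open>B\<close> along
the iterates, with \<open>\<kappa> = 1\<close> to their scalar products with differences of zeros.
\<close>

lemma averages_tendsto:
  fixes p c :: "nat \<Rightarrow> 'b::real_normed_vector"
  assumes \<kappa>: "0 < \<kappa>" "\<kappa> \<le> 1" and c: "c \<longlonglongrightarrow> l"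
    and rec: "\<And>k. 1 \<le> k \<Longrightarrow> p k = (1 - \<kappa> / t k) *\<^sub>R p (k - 1) + (\<kappa> / t k) *\<^sub>R c k"
  shows "p \<longlonglongrightarrow> l"
proof -
  have "(\<lambda>k. norm (p k - l)) \<longlonglongrightarrow> 0"
  proof (rule averaging_recursion_tendsto_zero)
    fix n
    show \<theta>: "0 \<le> \<kappa> / t (Suc n)" "\<kappa> / t (Suc n) \<le> 1"
      using t_ge_1[of "Suc n"] \<kappa> by (auto simp: field_simps)
    have "p (Suc n) - l = (1 - \<kappa> / t (Suc n)) *\<^sub>R (p n - l) + (\<kappa> / t (Suc n)) *\<^sub>R (c (Suc n) - l)"
      using rec[of "Suc n"] by (simp add: algebra_simps)
    then show "norm (p (Suc n) - l) \<le> (1 - \<kappa> / t (Suc n)) * norm (p n - l)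
        + \<kappa> / t (Suc n) * norm (c (Suc n) - l)"
      using norm_triangle_ineq[of "(1 - \<kappa> / t (Suc n)) *\<^sub>R (p n - l)"] \<theta>
      by (metis abs_of_nonneg diff_ge_0_iff_ge norm_scaleR)
  next
    show "\<not> summable (\<lambda>n. \<kappa> / t (Suc n))"
      using not_summable_inverse_t[OF \<kappa>(1)] summable_Suc_iff[of "\<lambda>n. \<kappa> / t n"] by blast
    show "(\<lambda>n. norm (c (Suc n) - l)) \<longlonglongrightarrow> 0"
      using c by (metis LIMSEQ_Suc Lim_null tendsto_norm_zero)
  qed simp
  then show ?thesis by (metis Lim_null tendsto_norm_zero_iff)
qed

lemma v_scaled: "1 \<le> k \<Longrightarrow> \<eta> *\<^sub>R (v k - w) = \<eta> *\<^sub>R (z (k - 1) - w) + t k *\<^sub>R (z k - z (k - 1))"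
  using \<eta>_pos by (simp add: v_def algebra_simps)

lemma z_average: "1 \<le> k \<Longrightarrow> z k - w = (1 - \<eta> / t k) *\<^sub>R (z (k - 1) - w) + (\<eta> / t k) *\<^sub>R (v k - w)"
proof -
  assume k: "1 \<le> k"
  have "(\<eta> / t k) *\<^sub>R (v k - w) = (1 / t k) *\<^sub>R (\<eta> *\<^sub>R (v k - w))" by simp
  also have "\<dots> = (\<eta> / t k) *\<^sub>R (z (k - 1) - w) + (z k - z (k - 1))"
    unfolding v_scaled[OF k] using t_ge_1[OF k] by (simp add: scaleR_add_right)
  finally show ?thesis by (simp add: algebra_simps)
qed

lemma momentum_step:
  assumes k: "1 \<le> k"
  shows "t (Suc k) *\<^sub>R (z (Suc k) - z k) = (t k - 1) *\<^sub>R (z k - z (k - 1))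
           - t (Suc k) *\<^sub>R (extrapolate t z k - z (Suc k))"
  using t_ge_1[of "Suc k"] by (simp add: extrapolate_def scaleR_add_right scaleR_diff_right)

lemma displacement:
  assumes k: "1 \<le> k"
  shows "extrapolate t z k - z (Suc k) = G (extrapolate t z k) + B (v (Suc k))"
  by (subst step[OF k]) (simp add: v_def)

lemma energy_nonneg: "0 \<le> energy w k"
  unfolding energy_def using bregman_nonneg \<eta>_pos \<eta>_le_1 by simp

text \<open>
Because \<open>B\<close> is evaluated exactly at \<open>v (Suc k)\<close> and is skew, it drops out of the scalar product of
the displacement with \<open>v (Suc k) - w\<close>; only the gradient of the Bregman distance at the extrapolated
point is left. The descent inequality towards the two points \<open>w\<close> and \<open>z k\<close>, weighted by
\<open>\<eta>\<close> and \<open>t (Suc k) - \<eta>\<close>, bounds it from below, and the resulting squares of the displacement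
cancel exactly. The growth condition on \<open>t\<close> makes the remaining multiple of the Bregman
distance dissipative.
\<close>

lemma energy_decrease:
  assumes w: "w \<in> zeros" and k: "1 \<le> k"
  shows "energy w (Suc k) + ((\<eta> - \<rho>) * (t k * bregman (z k) w)
           + (1 - \<eta>) / 2 * (t k * (norm (z k - z (k - 1)))\<^sup>2)) \<le> energy w k"
proof -
  define xb where "xb = extrapolate t z k"
  define q where "q = xb - z (Suc k)"
  define d where "d = z k - z (k - 1)"
  define \<tau> where "\<tau> = t (Suc k)"
  define u u' where "u = \<eta> *\<^sub>R (v k - w)" and "u' = \<eta> *\<^sub>R (v (Suc k) - w)"
  define \<gamma> where "\<gamma> = G xb - G w"
  have \<tau>: "1 \<le> \<tau>" "t k \<le> \<tau>" "\<tau>\<^sup>2 \<le> (t k)\<^sup>2 + \<rho> * \<tau>" and tk: "1 \<le> t k"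
    using t_ge_1[OF k] t_ge_1[of "Suc k"] t_growth[OF k] t_Suc_ge[OF k] by (auto simp: \<tau>_def)
  have u: "u = \<eta> *\<^sub>R (z k - w) + (t k - \<eta>) *\<^sub>R d"
    using v_scaled[OF k] by (simp add: u_def d_def algebra_simps)
  have u'_z: "u' = \<eta> *\<^sub>R (z k - w) + \<tau> *\<^sub>R (z (Suc k) - z k)"
    using v_scaled[of "Suc k"] by (simp add: u'_def \<tau>_def)
  have u': "u' = u - (1 - \<eta>) *\<^sub>R d - \<tau> *\<^sub>R q"
    unfolding u u'_z using momentum_step[OF k]
    by (simp add: q_def d_def xb_def \<tau>_def algebra_simps)
  \<comment> \<open>The skew part contributes nothing along \<open>u'\<close>.\<close>
  have q_u': "q \<bullet> u' = \<gamma> \<bullet> u'"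
  proof -
    have "q - \<gamma> = B (v (Suc k) - w)"
      using displacement[OF k] w
      by (simp add: q_def \<gamma>_def xb_def zeros_def B_diff algebra_simps add_eq_0_iff)
    then have "(q - \<gamma>) \<bullet> u' = 0"
      using skew by (simp add: u'_def)
    then show ?thesis by (simp add: inner_simps)
  qed
  \<comment> \<open>Parabola from the extrapolated point to the new iterate, tangent from it to \<open>p\<close>.\<close>
  have descent: "bregman (z (Suc k)) w \<le> bregman p w + \<gamma> \<bullet> (z (Suc k) - p) + (norm q)\<^sup>2 / 2" for p
    using below_parabola[of "z (Suc k)" xb] above_tangent[of xb p]
    by (simp add: bregman_def \<gamma>_def q_def norm_minus_commute inner_simps)
  have key: "\<tau> * (\<gamma> \<bullet> u') \<ge> \<tau>\<^sup>2 * bregman (z (Suc k)) w - \<tau> * (\<tau> - \<eta>) * bregman (z k) w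
      - \<tau>\<^sup>2 / 2 * (norm q)\<^sup>2"
  proof -
    have "\<gamma> \<bullet> u' = \<eta> * (\<gamma> \<bullet> (z (Suc k) - w)) + (\<tau> - \<eta>) * (\<gamma> \<bullet> (z (Suc k) - z k))"
      unfolding u'_z by (simp add: inner_simps algebra_simps)
    moreover have "\<eta> * (\<gamma> \<bullet> (z (Suc k) - w)) \<ge> \<eta> * (bregman (z (Suc k)) w - (norm q)\<^sup>2 / 2)"
      using descent[of w] \<eta>_pos by (intro mult_left_mono) (auto simp: bregman_def)
    moreover have "(\<tau> - \<eta>) * (\<gamma> \<bullet> (z (Suc k) - z k))
        \<ge> (\<tau> - \<eta>) * (bregman (z (Suc k)) w - bregman (z k) w - (norm q)\<^sup>2 / 2)"
      using descent[of "z k"] \<tau> \<eta>_le_1 by (intro mult_left_mono) auto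
    ultimately have "\<gamma> \<bullet> u' \<ge> \<tau> * bregman (z (Suc k)) w - (\<tau> - \<eta>) * bregman (z k) w
        - \<tau> / 2 * (norm q)\<^sup>2"
      by (simp add: left_diff_distrib right_diff_distrib) argo
    from mult_left_mono[OF this, of \<tau>] show ?thesis
      using \<tau> by (simp add: power2_eq_square algebra_simps)
  qed
  have "energy w (Suc k) + ((t k)\<^sup>2 - \<tau>\<^sup>2 + \<eta> * \<tau>) * bregman (z k) w
      + (1 - \<eta>) * (t k - 1 / 2) * (norm d)\<^sup>2 \<le> energy w k"
  proof -
    have "energy w (Suc k) = \<tau>\<^sup>2 * bregman (z (Suc k)) w + (norm u')\<^sup>2 / 2
        + \<eta> * (1 - \<eta>) / 2 * (norm (z k - w))\<^sup>2"
      by (simp add: energy_def u'_def \<tau>_def)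
    moreover have "energy w k = (t k)\<^sup>2 * bregman (z k) w + (norm u)\<^sup>2 / 2
        + \<eta> * (1 - \<eta>) / 2 * (norm (z k - w - d))\<^sup>2"
      by (simp add: energy_def u_def d_def)
    moreover have "((t k)\<^sup>2 - \<tau>\<^sup>2 + \<eta> * \<tau>) * bregman (z k) w
        = (t k)\<^sup>2 * bregman (z k) w - \<tau> * (\<tau> - \<eta>) * bregman (z k) w"
      by (simp add: power2_eq_square algebra_simps)
    ultimately show ?thesis
      using momentum_energy_identity[OF u u', unfolded q_u'] key by linarith
  qed
  moreover have "(\<eta> - \<rho>) * (t k * bregman (z k) w) \<le> ((t k)\<^sup>2 - \<tau>\<^sup>2 + \<eta> * \<tau>) * bregman (z k) w"
  proof -
    have "(\<eta> - \<rho>) * t k \<le> (\<eta> - \<rho>) * \<tau>" using \<tau> \<rho>_le_\<eta> by (simp add: mult_left_mono)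
    also have "\<dots> \<le> (t k)\<^sup>2 - \<tau>\<^sup>2 + \<eta> * \<tau>" using \<tau> by (simp add: algebra_simps)
    finally show ?thesis
      using mult_right_mono[OF _ bregman_nonneg] by (metis mult.assoc)
  qed
  moreover have "(1 - \<eta>) / 2 * (t k * (norm d)\<^sup>2) \<le> (1 - \<eta>) * (t k - 1 / 2) * (norm d)\<^sup>2"
  proof -
    have "(1 - \<eta>) * (t k / 2) \<le> (1 - \<eta>) * (t k - 1 / 2)"
      using tk \<eta>_le_1 by (intro mult_left_mono) auto
    from mult_right_mono[OF this, of "(norm d)\<^sup>2"] show ?thesis by simp
  qed
  ultimately show ?thesis by (simp add: d_def)
qed

section \<open>Boundedness and convergence of the iterates\<close>

lemma energy_convergent: "w \<in> zeros \<Longrightarrow> convergent (energy w)"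
  and dissipation_summable: "w \<in> zeros \<Longrightarrow> summable (\<lambda>n.
    (\<eta> - \<rho>) * (t (Suc n) * bregman (z (Suc n)) w)
      + (1 - \<eta>) / 2 * (t (Suc n) * (norm (z (Suc n) - z n))\<^sup>2))"
proof -
  assume w: "w \<in> zeros"
  have nonneg: "0 \<le> (\<eta> - \<rho>) * (t (Suc n) * bregman (z (Suc n)) w)
      + (1 - \<eta>) / 2 * (t (Suc n) * (norm (z (Suc n) - z n))\<^sup>2)" for n
    using t_ge_1[of "Suc n"] \<rho>_le_\<eta> \<eta>_le_1 bregman_nonneg by simp
  note diss = dissipated_energy[of "\<lambda>n. energy w (Suc n)", OF energy_nonneg nonneg]
  have "energy w (Suc (Suc n)) + ((\<eta> - \<rho>) * (t (Suc n) * bregman (z (Suc n)) w)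
      + (1 - \<eta>) / 2 * (t (Suc n) * (norm (z (Suc n) - z n))\<^sup>2)) \<le> energy w (Suc n)" for n
    using energy_decrease[OF w, of "Suc n"] by simp
  note diss = diss[OF this]
  show "convergent (energy w)"
    using diss(1) convergent_Suc_iff by blast
  show "summable (\<lambda>n. (\<eta> - \<rho>) * (t (Suc n) * bregman (z (Suc n)) w)
      + (1 - \<eta>) / 2 * (t (Suc n) * (norm (z (Suc n) - z n))\<^sup>2))"
    by (rule diss(2))
qed

lemma energy_le_initial: "w \<in> zeros \<Longrightarrow> 1 \<le> k \<Longrightarrow> energy w k \<le> energy w 1"
proof -
  assume w: "w \<in> zeros"
  show "1 \<le> k \<Longrightarrow> energy w k \<le> energy w 1"
  proof (induction k rule: dec_induct)
    case (step k)
    have "0 \<le> (\<eta> - \<rho>) * (t k * bregman (z k) w) + (1 - \<eta>) / 2 * (t k * (norm (z k - z (k - 1)))\<^sup>2)"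
      using t_ge_1[OF step(1)] \<rho>_le_\<eta> \<eta>_le_1 bregman_nonneg by simp
    then show ?case using energy_decrease[OF w step(1)] step.IH by linarith
  qed simp
qed

text \<open>
For \<open>\<eta> = 1\<close> the energy bounds \<open>v k - w\<close> but not \<open>z k - w\<close> directly. The iterates stay in a
ball around \<open>w\<close> since they are successive convex combinations of these points.
\<close>

lemma iterate_bounds:
  assumes w: "w \<in> zeros"
  obtains C where "0 \<le> C" and "\<And>k. norm (z k - w) \<le> C"
    and "\<And>k. 1 \<le> k \<Longrightarrow> (t k)\<^sup>2 * bregman (z k) w \<le> C"
    and "\<And>k. 1 \<le> k \<Longrightarrow> t k * norm (z k - z (k - 1)) \<le> C"
proof -
  define E\<^sub>1 where "E\<^sub>1 = energy w 1"
  define V where "V = sqrt (2 * E\<^sub>1)"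
  define M where "M = max (V / \<eta>) (norm (z 0 - w))"
  have "0 \<le> E\<^sub>1" by (simp add: E\<^sub>1_def energy_nonneg)
  then have "0 \<le> V" by (simp add: V_def)
  have V: "norm (\<eta> *\<^sub>R (v k - w)) \<le> V" if "1 \<le> k" for k
  proof -
    have "0 \<le> (t k)\<^sup>2 * bregman (z k) w" "0 \<le> \<eta> * (1 - \<eta>) / 2 * (norm (z (k - 1) - w))\<^sup>2"
      using bregman_nonneg \<eta>_pos \<eta>_le_1 by auto
    then have "(norm (\<eta> *\<^sub>R (v k - w)))\<^sup>2 \<le> 2 * E\<^sub>1"
      using energy_le_initial[OF w that] unfolding E\<^sub>1_def energy_def[of w k] by linarith
    then show ?thesis unfolding V_def by (rule real_le_rsqrt)
  qed
  have M: "norm (z k - w) \<le> M" for k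
  proof (induction k)
    case (Suc k)
    have \<theta>: "0 \<le> \<eta> / t (Suc k)" "\<eta> / t (Suc k) \<le> 1"
      using t_ge_1[of "Suc k"] \<eta>_pos \<eta>_le_1 by auto
    have "norm (v (Suc k) - w) \<le> V / \<eta>"
      using V[of "Suc k", unfolded norm_scaleR] \<eta>_pos by (simp add: pos_le_divide_eq mult.commute)
    then have "norm (v (Suc k) - w) \<le> M" by (simp add: M_def)
    have "norm (z (Suc k) - w) \<le> (1 - \<eta> / t (Suc k)) * norm (z k - w)
        + \<eta> / t (Suc k) * norm (v (Suc k) - w)"
      using z_average[of "Suc k" w] \<theta> norm_triangle_ineq[of "(1 - \<eta> / t (Suc k)) *\<^sub>R (z k - w)"]
      by (metis One_nat_def Suc_le_mono abs_of_nonneg diff_Suc_1 diff_ge_0_iff_ge le0 norm_scaleR)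
    also have "\<dots> \<le> (1 - \<eta> / t (Suc k)) * M + \<eta> / t (Suc k) * M"
      using Suc \<open>norm (v (Suc k) - w) \<le> M\<close> \<theta>
      by (intro add_mono mult_left_mono) auto
    finally show ?case by (simp add: algebra_simps)
  qed (simp add: M_def)
  have D: "(t k)\<^sup>2 * bregman (z k) w \<le> E\<^sub>1" if "1 \<le> k" for k
  proof -
    have "0 \<le> \<eta> * (1 - \<eta>) / 2 * (norm (z (k - 1) - w))\<^sup>2"
      using \<eta>_pos \<eta>_le_1 by auto
    moreover have "0 \<le> (norm (\<eta> *\<^sub>R (v k - w)))\<^sup>2 / 2" by simp
    ultimately show ?thesis
      using energy_le_initial[OF w that] unfolding E\<^sub>1_def energy_def[of w k] by linarith
  qed
  have I: "t k * norm (z k - z (k - 1)) \<le> V + \<eta> * M" if k: "1 \<le> k" for k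
  proof -
    have "t k *\<^sub>R (z k - z (k - 1)) = \<eta> *\<^sub>R (v k - w) - \<eta> *\<^sub>R (z (k - 1) - w)"
      using v_scaled[OF k, of w] by simp
    then have "norm (t k *\<^sub>R (z k - z (k - 1))) \<le> V + norm (\<eta> *\<^sub>R (z (k - 1) - w))"
      using norm_triangle_ineq4[of "\<eta> *\<^sub>R (v k - w)" "\<eta> *\<^sub>R (z (k - 1) - w)"] V[OF k] by simp
    also have "norm (\<eta> *\<^sub>R (z (k - 1) - w)) \<le> \<eta> * M"
      using M[of "k - 1"] \<eta>_pos by simp
    finally show ?thesis using t_ge_1[OF k] by simp
  qed
  define C where "C = max M (max E\<^sub>1 (V + \<eta> * M))"
  show thesis
  proof (rule that[of C])
    show "0 \<le> C" using \<open>0 \<le> E\<^sub>1\<close> by (simp add: C_def)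
    show "norm (z k - w) \<le> C" for k using M[of k] by (simp add: C_def)
    show "(t k)\<^sup>2 * bregman (z k) w \<le> C" if "1 \<le> k" for k using D[OF that] by (simp add: C_def)
    show "t k * norm (z k - z (k - 1)) \<le> C" if "1 \<le> k" for k using I[OF that] by (simp add: C_def)
  qed
qed

lemma inverse_t_tendsto_zero: "(\<lambda>k. c / t k) \<longlonglongrightarrow> 0"
  using t_unbounded by (intro tendsto_divide_0[OF tendsto_const] filterlim_at_top_imp_at_infinity)

lemma tendsto_zero_of_t_bounded:
  fixes p :: "nat \<Rightarrow> 'b::real_normed_vector"
  assumes "\<And>k. 1 \<le> k \<Longrightarrow> t k * norm (p k) \<le> C"
  shows "p \<longlonglongrightarrow> 0"
proof (rule Lim_null_comparison)
  show "\<forall>\<^sub>F k in sequentially. norm (p k) \<le> C / t k"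
    using eventually_ge_at_top[of 1]
  proof eventually_elim
    case (elim k)
    then show ?case using assms[OF elim] t_ge_1[OF elim] by (simp add: field_simps)
  qed
qed (rule inverse_t_tendsto_zero)

lemma scaled_gradient_error:
  assumes "1 \<le> k"
  shows "t k * norm (G (z k) - G w) \<le> sqrt (2 * ((t k)\<^sup>2 * bregman (z k) w))"
proof (rule real_le_rsqrt)
  have "(t k)\<^sup>2 * (norm (G (z k) - G w))\<^sup>2 \<le> (t k)\<^sup>2 * (2 * bregman (z k) w)"
    by (intro mult_left_mono norm_gradient_diff_le_bregman) simp
  then show "(t k * norm (G (z k) - G w))\<^sup>2 \<le> 2 * ((t k)\<^sup>2 * bregman (z k) w)"
    by (simp add: power_mult_distrib)
qed

lemma scaled_extrapolation_error:
  assumes "1 \<le> k"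
  shows "t (Suc k) * norm (extrapolate t z k - z k) \<le> t k * norm (z k - z (k - 1))"
proof -
  have "t (Suc k) * norm (extrapolate t z k - z k) = (t k - 1) * norm (z k - z (k - 1))"
    using t_ge_1[OF assms] t_ge_1[of "Suc k"] by (simp add: extrapolate_def)
  also have "\<dots> \<le> t k * norm (z k - z (k - 1))" by (intro mult_right_mono) auto
  finally show ?thesis .
qed

text \<open>
Solving the iteration for \<open>B (v (Suc k))\<close> leaves increments and gradient errors, all of order
\<open>1 / t k\<close>.
\<close>

lemma scaled_v_error:
  assumes w: "w \<in> zeros" and k: "1 \<le> k"
  shows "t (Suc k) * norm (B (v (Suc k)) - B w) \<le> 2 * (t k * norm (z k - z (k - 1)))
    + t (Suc k) * norm (z (Suc k) - z k) + 2 * (t k * norm (G (z k) - G w))"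
proof -
  define xb where "xb = extrapolate t z k"
  have t: "0 < t (Suc k)" "t (Suc k) \<le> 2 * t k"
    using t_ge_1[OF k] t_ge_1[of "Suc k"] t_Suc_le[OF k] \<rho>_le_\<eta> \<eta>_le_1 by auto
  have "B (v (Suc k)) - B w = (xb - z k) - (z (Suc k) - z k) - (G xb - G (z k)) - (G (z k) - G w)"
    using displacement[OF k] w by (simp add: zeros_def xb_def algebra_simps add_eq_0_iff)
  moreover have "norm (a - b - c - e) \<le> norm a + norm b + norm c + norm e" for a b c e :: 'a
    using norm_triangle_ineq4[of "a - b - c" e] norm_triangle_ineq4[of "a - b" c]
      norm_triangle_ineq4[of a b] by linarith
  ultimately have "norm (B (v (Suc k)) - B w) \<le> norm (xb - z k) + norm (z (Suc k) - z k)
      + norm (G xb - G (z k)) + norm (G (z k) - G w)"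
    by presburger
  also have "norm (G xb - G (z k)) \<le> norm (xb - z k)" by (rule gradient_nonexpansive)
  finally have "t (Suc k) * norm (B (v (Suc k)) - B w)
      \<le> t (Suc k) * (norm (xb - z k) + norm (z (Suc k) - z k) + norm (xb - z k) + norm (G (z k) - G w))"
    using t(1) by simp
  also have "\<dots> = 2 * (t (Suc k) * norm (xb - z k)) + t (Suc k) * norm (z (Suc k) - z k)
      + t (Suc k) * norm (G (z k) - G w)"
    by (simp add: algebra_simps)
  also have "\<dots> \<le> 2 * (t k * norm (z k - z (k - 1))) + t (Suc k) * norm (z (Suc k) - z k)
      + 2 * t k * norm (G (z k) - G w)"
    using scaled_extrapolation_error[OF k] t(2)
    by (intro add_mono mult_right_mono) (auto simp: xb_def)
  finally show ?thesis by simp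
qed

lemma gradient_tendsto:
  assumes w: "w \<in> zeros"
  shows "(\<lambda>k. G (z k)) \<longlonglongrightarrow> G w"
proof -
  obtain C where C: "\<And>k. 1 \<le> k \<Longrightarrow> (t k)\<^sup>2 * bregman (z k) w \<le> C" using iterate_bounds[OF w] by metis
  have "t k * norm (G (z k) - G w) \<le> sqrt (2 * C)" if "1 \<le> k" for k
    by (rule order_trans[OF scaled_gradient_error[OF that]]) (use C[OF that] in simp)
  then have "(\<lambda>k. G (z k) - G w) \<longlonglongrightarrow> 0" by (rule tendsto_zero_of_t_bounded)
  then show ?thesis by (rule Lim_null[THEN iffD2])
qed

lemma B_average: "1 \<le> k \<Longrightarrow> B (z k - w) = (1 - \<eta> / t k) *\<^sub>R B (z (k - 1) - w) + (\<eta> / t k) *\<^sub>R B (v k - w)"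
  by (subst z_average) (simp_all only: B_add B_scaleR)

lemma skew_part_tendsto:
  assumes w: "w \<in> zeros"
  shows "(\<lambda>k. B (z k)) \<longlonglongrightarrow> B w"
proof -
  obtain C where C: "\<And>k. 1 \<le> k \<Longrightarrow> (t k)\<^sup>2 * bregman (z k) w \<le> C"
    and I: "\<And>k. 1 \<le> k \<Longrightarrow> t k * norm (z k - z (k - 1)) \<le> C"
    using iterate_bounds[OF w] by metis
  have "t k * norm (B (v (Suc k)) - B w) \<le> 2 * C + C + 2 * sqrt (2 * C)" if k: "1 \<le> k" for k
  proof -
    have "t k * norm (B (v (Suc k)) - B w) \<le> t (Suc k) * norm (B (v (Suc k)) - B w)"
      using t_Suc_ge[OF k] by (intro mult_right_mono) auto
    also note scaled_v_error[OF w k]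
    also have "t k * norm (G (z k) - G w) \<le> sqrt (2 * C)"
      by (rule order_trans[OF scaled_gradient_error[OF k]]) (use C[OF k] in simp)
    finally show ?thesis using I[OF k] I[of "Suc k"] by simp
  qed
  then have "(\<lambda>k. B (v (Suc k)) - B w) \<longlonglongrightarrow> 0" by (rule tendsto_zero_of_t_bounded)
  then have "(\<lambda>k. B (v (Suc k) - w)) \<longlonglongrightarrow> 0" by (simp add: B_diff)
  then have "(\<lambda>k. B (v k - w)) \<longlonglongrightarrow> 0" by (rule LIMSEQ_imp_Suc)
  then have "(\<lambda>k. B (z k - w)) \<longlonglongrightarrow> 0"
    by (rule averages_tendsto[OF \<eta>_pos \<eta>_le_1]) (rule B_average)
  then show ?thesis unfolding B_diff by (rule Lim_null[THEN iffD2])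
qed

text \<open>
Although the iterates are not yet known to converge, \<open>G\<close> and \<open>B\<close> along them do, so every cluster point
satisfies the optimality equation.
\<close>

lemma cluster_point_zero:
  assumes w: "w \<in> zeros" and \<sigma>: "strict_mono \<sigma>" and lim: "(z \<circ> \<sigma>) \<longlonglongrightarrow> p"
  shows "p \<in> zeros"
proof -
  have "(\<lambda>n. G (z (\<sigma> n)) + B (z (\<sigma> n))) \<longlonglongrightarrow> G w + B w"
    using LIMSEQ_subseq_LIMSEQ[OF gradient_tendsto[OF w] \<sigma>]
      LIMSEQ_subseq_LIMSEQ[OF skew_part_tendsto[OF w] \<sigma>]
    by (intro tendsto_add) (simp_all add: o_def)
  moreover have "(\<lambda>n. G (z (\<sigma> n)) + B (z (\<sigma> n))) \<longlonglongrightarrow> G p + B p"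
    using lim isCont_tendsto_compose[OF continuous_gradient] isCont_tendsto_compose[OF continuous_B]
    by (intro tendsto_add) (simp_all add: o_def)
  ultimately show ?thesis
    using LIMSEQ_unique w by (fastforce simp: zeros_def)
qed

text \<open>
The Bregman terms and all squares of iterates cancel, and what survives is affine in the projection of the
iterates on \<open>w' - w\<close>.
\<close>

lemma energy_difference:
  assumes "w \<in> zeros" "w' \<in> zeros" "1 \<le> k"
  shows "energy w k - energy w' k = \<eta> * (z (k - 1) \<bullet> (w' - w) + t k * ((z k - z (k - 1)) \<bullet> (w' - w)))
    + \<eta> / 2 * ((norm w)\<^sup>2 - (norm w')\<^sup>2)"
proof -
  define a d where "a = z (k - 1)" and "d = z k - z (k - 1)"
  have "bregman (z k) w = bregman (z k) w'"
    using zeros_eq_gradient_and_bregman assms by blast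
  then have "energy w k - energy w' k =
      (norm (\<eta> *\<^sub>R (a - w) + t k *\<^sub>R d))\<^sup>2 / 2 - (norm (\<eta> *\<^sub>R (a - w') + t k *\<^sub>R d))\<^sup>2 / 2
      + \<eta> * (1 - \<eta>) / 2 * ((norm (a - w))\<^sup>2 - (norm (a - w'))\<^sup>2)"
    unfolding energy_def v_scaled[OF assms(3)] by (simp add: a_def d_def algebra_simps)
  also have "\<dots> = \<eta> * (a \<bullet> (w' - w) + t k * (d \<bullet> (w' - w))) + \<eta> / 2 * ((norm w)\<^sup>2 - (norm w')\<^sup>2)"
    unfolding power2_norm_eq_inner
    by (simp add: inner_simps inner_commute field_simps)
  finally show ?thesis by (simp add: a_def d_def)
qed

text \<open>
Both energies converge, hence so does \<open>h (k - 1) + t k * (h k - h (k - 1))\<close> for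
\<open>h k = z k \<bullet> (w' - w)\<close>; and \<open>h k\<close> is an average of \<open>h (k - 1)\<close> and this quantity.
\<close>

lemma projection_convergent:
  assumes w: "w \<in> zeros" "w' \<in> zeros"
  shows "convergent (\<lambda>k. z k \<bullet> (w' - w))"
proof -
  define e where "e = w' - w"
  define a where "a k = (energy w k - energy w' k - \<eta> / 2 * ((norm w)\<^sup>2 - (norm w')\<^sup>2)) / \<eta>" for k
  obtain l\<^sub>1 l\<^sub>2 where lims: "energy w \<longlonglongrightarrow> l\<^sub>1" "energy w' \<longlonglongrightarrow> l\<^sub>2"
    using energy_convergent[OF w(1)] energy_convergent[OF w(2)] unfolding convergent_def by auto
  have "\<eta> \<noteq> 0" using \<eta>_pos by simp
  then have "a \<longlonglongrightarrow> (l\<^sub>1 - l\<^sub>2 - \<eta> / 2 * ((norm w)\<^sup>2 - (norm w')\<^sup>2)) / \<eta>"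
    unfolding a_def by (intro tendsto_divide[OF tendsto_diff[OF tendsto_diff[OF lims] tendsto_const] tendsto_const])
  then obtain l where l: "a \<longlonglongrightarrow> l" by blast
  have rec: "z k \<bullet> e = (1 - 1 / t k) *\<^sub>R (z (k - 1) \<bullet> e) + (1 / t k) *\<^sub>R a k" if k: "1 \<le> k" for k
  proof -
    have "a k = z (k - 1) \<bullet> e + t k * ((z k - z (k - 1)) \<bullet> e)"
      using energy_difference[OF w k] \<eta>_pos by (simp add: a_def e_def)
    then show ?thesis using t_ge_1[OF k] by (simp add: inner_simps field_simps)
  qed
  have "(\<lambda>k. z k \<bullet> e) \<longlonglongrightarrow> l"
    by (rule averages_tendsto[OF zero_less_one order_refl l rec])
  then show ?thesis by (auto simp: convergent_def e_def)
qed

text \<open>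
Two cluster points \<open>p\<close> and \<open>p'\<close> are zeros, and the convergent projection on \<open>p' - p\<close>
takes its limit at both of them, so they coincide.
\<close>

theorem iterates_converge:
  assumes "zeros \<noteq> {}"
  shows "\<exists>p \<in> zeros. z \<longlonglongrightarrow> p"
proof -
  obtain w where w: "w \<in> zeros" using assms by blast
  obtain C where C: "\<And>k. norm (z k - w) \<le> C" using iterate_bounds[OF w] by metis
  have "z k \<in> cball w C" for k using C[of k] by (simp add: dist_norm norm_minus_commute)
  then have bdd: "bounded (range (z \<circ> \<sigma>))" for \<sigma> :: "nat \<Rightarrow> nat"
    by (intro bounded_subset[OF bounded_cball]) auto
  obtain p \<sigma> where \<sigma>: "strict_mono \<sigma>" "(z \<circ> \<sigma>) \<longlonglongrightarrow> p"
    using bounded_imp_convergent_subsequence[OF bdd[of id]] by auto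
  have p: "p \<in> zeros" by (rule cluster_point_zero[OF w \<sigma>])
  have "z \<longlonglongrightarrow> p"
  proof (rule ccontr)
    assume "\<not> z \<longlonglongrightarrow> p"
    then obtain e where e: "0 < e" "\<not> (\<forall>\<^sub>F k in sequentially. dist (z k) p < e)"
      by (auto simp: tendsto_iff)
    \<comment> \<open>Indices that stay away from \<open>p\<close>; a second cluster point is extracted from them.\<close>
    define S where "S = {k. e \<le> dist (z k) p}"
    have "infinite S"
      using e(2) unfolding S_def infinite_nat_iff_unbounded_le eventually_sequentially
      by (auto simp: not_less)
    note S = strict_mono_enumerate[OF this] enumerate_in_set[OF this]
    obtain p' \<tau> where \<tau>: "strict_mono \<tau>" "(z \<circ> enumerate S \<circ> \<tau>) \<longlonglongrightarrow> p'"
      using bounded_imp_convergent_subsequence[OF bdd[of "enumerate S"]] by auto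
    have mono': "strict_mono (enumerate S \<circ> \<tau>)" using S(1) \<tau>(1) by (rule strict_mono_o)
    have \<tau>': "(z \<circ> (enumerate S \<circ> \<tau>)) \<longlonglongrightarrow> p'" using \<tau>(2) by (simp add: o_assoc)
    have p': "p' \<in> zeros" by (rule cluster_point_zero[OF w mono' \<tau>'])
    obtain l where l: "(\<lambda>k. z k \<bullet> (p' - p)) \<longlonglongrightarrow> l"
      using projection_convergent[OF p p'] by (auto simp: convergent_def)
    have "p \<bullet> (p' - p) = l"
      using LIMSEQ_subseq_LIMSEQ[OF l \<sigma>(1)] tendsto_inner[OF \<sigma>(2) tendsto_const, of "p' - p"]
      by (intro LIMSEQ_unique) (simp_all add: o_def)
    moreover have "p' \<bullet> (p' - p) = l"
      using LIMSEQ_subseq_LIMSEQ[OF l mono'] tendsto_inner[OF \<tau>' tendsto_const, of "p' - p"]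
      by (intro LIMSEQ_unique) (simp_all add: o_def)
    ultimately have "(p' - p) \<bullet> (p' - p) = 0" by (simp add: inner_diff_left)
    then have "p' = p" by simp
    have "e \<le> dist ((z \<circ> (enumerate S \<circ> \<tau>)) n) p" for n
      using S(2)[of "\<tau> n"] by (simp add: S_def)
    moreover have "(\<lambda>n. dist ((z \<circ> (enumerate S \<circ> \<tau>)) n) p) \<longlonglongrightarrow> dist p' p"
      using \<tau>' by (intro tendsto_dist tendsto_const)
    ultimately have "e \<le> dist p' p" using LIMSEQ_le_const by blast
    with \<open>p' = p\<close> e(1) show False by simp
  qed
  with p show ?thesis by blast
qed

section \<open>Little-o rates\<close>

text \<open>
At the limit point the energy reduces, up to vanishing terms, to the Bregman part \<open>D\<close> plus
the velocity part \<open>V\<close>. So \<open>D + V\<close> converges, while strict parameters make \<open>(D + V) / t\<close>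
summable; the limit is therefore 0. The gradient error is controlled by the Bregman distance. For the
skew part, \<open>t k * B (z k - w)\<close> obeys a recursion with contraction factor
\<open>1 - (\<eta> - \<rho>) / t k\<close> and a forcing term of smaller order.
\<close>

theorem fast_rates:
  assumes w: "w \<in> zeros" and lim: "z \<longlonglongrightarrow> w" and strict: "\<rho> < \<eta>" "\<eta> < 1"
  shows "(\<lambda>k. (t k)\<^sup>2 * bregman (z k) w) \<longlonglongrightarrow> 0"
    and "(\<lambda>k. t k * norm (z k - z (k - 1))) \<longlonglongrightarrow> 0"
    and "(\<lambda>k. t k * norm (G (z k) + B (z k))) \<longlonglongrightarrow> 0"
proof -
  define D where "D k = (t k)\<^sup>2 * bregman (z k) w" for k
  define V where "V k = (t k * norm (z k - z (k - 1)))\<^sup>2 / 2" for k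
  have D_nonneg: "0 \<le> D k" and V_nonneg: "0 \<le> V k" for k
    by (simp_all add: D_def V_def bregman_nonneg)
  obtain C where I: "\<And>k. 1 \<le> k \<Longrightarrow> t k * norm (z k - z (k - 1)) \<le> C"
    using iterate_bounds[OF w] by metis
  obtain l where l: "energy w \<longlonglongrightarrow> l"
    using energy_convergent[OF w] by (auto simp: convergent_def)
  have shift: "(\<lambda>k. z (k - 1) - w) \<longlonglongrightarrow> 0"
    by (rule LIMSEQ_imp_Suc) (use lim[THEN Lim_null[THEN iffD1]] in simp)
  have cross: "(\<lambda>k. t k * ((z k - z (k - 1)) \<bullet> (z (k - 1) - w))) \<longlonglongrightarrow> 0"
  proof (rule Lim_null_comparison)
    show "\<forall>\<^sub>F k in sequentially. norm (t k * ((z k - z (k - 1)) \<bullet> (z (k - 1) - w)))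
        \<le> C * norm (z (k - 1) - w)"
      using eventually_ge_at_top[of 1]
    proof eventually_elim
      case (elim k)
      have "norm (t k * ((z k - z (k - 1)) \<bullet> (z (k - 1) - w)))
          \<le> t k * (norm (z k - z (k - 1)) * norm (z (k - 1) - w))"
        using t_ge_1[OF elim] Cauchy_Schwarz_ineq2 by (simp add: abs_mult mult_left_mono)
      also have "\<dots> \<le> C * norm (z (k - 1) - w)"
        using mult_right_mono[OF I[OF elim]] by (simp add: mult.assoc)
      finally show ?case .
    qed
    show "(\<lambda>k. C * norm (z (k - 1) - w)) \<longlonglongrightarrow> 0"
      using shift by (intro tendsto_mult_right_zero tendsto_norm_zero)
  qed
  have energy_expand: "D k + V k = energy w k - \<eta> * (t k * ((z k - z (k - 1)) \<bullet> (z (k - 1) - w)))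
      - \<eta> / 2 * (norm (z (k - 1) - w))\<^sup>2" if k: "1 \<le> k" for k
  proof -
    define a d where "a = z (k - 1) - w" and "d = z k - z (k - 1)"
    have "(norm (\<eta> *\<^sub>R a + t k *\<^sub>R d))\<^sup>2
        = \<eta>\<^sup>2 * (norm a)\<^sup>2 + 2 * \<eta> * (t k * (d \<bullet> a)) + (t k * norm d)\<^sup>2"
      unfolding power_mult_distrib power2_norm_eq_inner
      by (simp add: inner_simps inner_commute power2_eq_square algebra_simps)
    then show ?thesis
      unfolding energy_def v_scaled[OF k] D_def V_def a_def[symmetric] d_def[symmetric]
      by (simp add: power2_eq_square field_simps)
  qed
  have "(\<lambda>k. energy w k - \<eta> * (t k * ((z k - z (k - 1)) \<bullet> (z (k - 1) - w)))
      - \<eta> / 2 * (norm (z (k - 1) - w))\<^sup>2) \<longlonglongrightarrow> l - \<eta> * 0 - \<eta> / 2 * (norm (0::'a))\<^sup>2" (is "?lhs \<longlonglongrightarrow> _")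
    by (intro tendsto_intros l cross shift)
  then have "?lhs \<longlonglongrightarrow> l" by (simp only: norm_zero power_zero_numeral mult_zero_right diff_zero)
  moreover have "\<forall>\<^sub>F k in sequentially. energy w k - \<eta> * (t k * ((z k - z (k - 1)) \<bullet> (z (k - 1) - w)))
      - \<eta> / 2 * (norm (z (k - 1) - w))\<^sup>2 = D k + V k"
    using eventually_ge_at_top[of 1] by eventually_elim (rule energy_expand[symmetric])
  ultimately have DV_l: "(\<lambda>k. D k + V k) \<longlonglongrightarrow> l"
    by (rule Lim_transform_eventually)
  have "l = 0"
  proof (rule nonsummable_weights_limit_zero)
    show "\<not> summable (\<lambda>n. 1 / t (Suc n))"
      using not_summable_inverse_t[of 1] summable_Suc_iff[of "\<lambda>n. 1 / t n"] by simp
    show "(\<lambda>n. D (Suc n) + V (Suc n)) \<longlonglongrightarrow> l" by (rule LIMSEQ_Suc[OF DV_l])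
    show "0 \<le> 1 / t (Suc n)" "0 \<le> D (Suc n) + V (Suc n)" for n
      using t_ge_1[of "Suc n"] D_nonneg V_nonneg by simp_all
    define c where "c = min (\<eta> - \<rho>) (1 - \<eta>)"
    have "0 < c" using strict by (simp add: c_def)
    show "summable (\<lambda>n. 1 / t (Suc n) * (D (Suc n) + V (Suc n)))"
    proof (rule summable_comparison_test)
      show "summable (\<lambda>n. 1 / c * ((\<eta> - \<rho>) * (t (Suc n) * bregman (z (Suc n)) w)
          + (1 - \<eta>) / 2 * (t (Suc n) * (norm (z (Suc n) - z n))\<^sup>2)))"
        by (intro summable_mult dissipation_summable[OF w])
      have "norm (1 / t (Suc n) * (D (Suc n) + V (Suc n)))
          \<le> 1 / c * ((\<eta> - \<rho>) * (t (Suc n) * bregman (z (Suc n)) w)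
          + (1 - \<eta>) / 2 * (t (Suc n) * (norm (z (Suc n) - z n))\<^sup>2))" for n
      proof -
        define P Q where "P = t (Suc n) * bregman (z (Suc n)) w"
          and "Q = t (Suc n) * (norm (z (Suc n) - z n))\<^sup>2"
        have t: "1 \<le> t (Suc n)" by (simp add: t_ge_1)
        have PQ: "0 \<le> P" "0 \<le> Q" using t bregman_nonneg by (simp_all add: P_def Q_def)
        have "1 / t (Suc n) * (D (Suc n) + V (Suc n)) = P + Q / 2"
          using t by (simp add: D_def V_def P_def Q_def power2_eq_square field_simps)
        moreover have "c * (P + Q / 2) \<le> (\<eta> - \<rho>) * P + (1 - \<eta>) / 2 * Q"
        proof -
          have "c * P \<le> (\<eta> - \<rho>) * P" "c * (Q / 2) \<le> (1 - \<eta>) * (Q / 2)"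
            using PQ by (intro mult_right_mono; simp add: c_def)+
          then show ?thesis by (simp add: distrib_left)
        qed
        then have "P + Q / 2 \<le> 1 / c * ((\<eta> - \<rho>) * P + (1 - \<eta>) / 2 * Q)"
          using \<open>0 < c\<close> by (simp add: pos_le_divide_eq mult.commute)
        ultimately show ?thesis
          using PQ unfolding P_def[symmetric] Q_def[symmetric] by simp
      qed
      then show "\<exists>N. \<forall>n\<ge>N. norm (1 / t (Suc n) * (D (Suc n) + V (Suc n)))
          \<le> 1 / c * ((\<eta> - \<rho>) * (t (Suc n) * bregman (z (Suc n)) w)
          + (1 - \<eta>) / 2 * (t (Suc n) * (norm (z (Suc n) - z n))\<^sup>2))" by blast
    qed
  qed
  with DV_l have DV: "(\<lambda>k. D k + V k) \<longlonglongrightarrow> 0" by simp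
  have D0: "D \<longlonglongrightarrow> 0" and V0: "V \<longlonglongrightarrow> 0"
    by (rule Lim_null_comparison[OF _ DV]; simp add: D_nonneg V_nonneg)+
  show "(\<lambda>k. (t k)\<^sup>2 * bregman (z k) w) \<longlonglongrightarrow> 0"
    using D0 unfolding D_def[abs_def] .
  have "(\<lambda>k. sqrt (2 * V k)) \<longlonglongrightarrow> sqrt (2 * 0)" by (intro tendsto_intros V0)
  moreover have "\<forall>\<^sub>F k in sequentially. sqrt (2 * V k) = t k * norm (z k - z (k - 1))"
    using eventually_ge_at_top[of 1]
    by eventually_elim (use t_ge_1 in \<open>force simp: V_def real_sqrt_mult\<close>)
  ultimately show d0: "(\<lambda>k. t k * norm (z k - z (k - 1))) \<longlonglongrightarrow> 0"
    by (simp add: Lim_transform_eventually)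
  have g0: "(\<lambda>k. t k * norm (G (z k) - G w)) \<longlonglongrightarrow> 0"
  proof (rule Lim_null_comparison)
    show "\<forall>\<^sub>F k in sequentially. norm (t k * norm (G (z k) - G w)) \<le> sqrt (2 * D k)"
      using eventually_ge_at_top[of 1]
    proof eventually_elim
      case (elim k)
      then show ?case using scaled_gradient_error[OF elim, of w] t_ge_1[OF elim] by (simp add: D_def abs_mult)
    qed
    have "(\<lambda>k. sqrt (2 * D k)) \<longlonglongrightarrow> sqrt (2 * 0)" by (intro tendsto_intros D0)
    then show "(\<lambda>k. sqrt (2 * D k)) \<longlonglongrightarrow> 0" by simp
  qed
  \<comment> \<open>The bound of \<open>scaled_v_error\<close>, which now tends to zero.\<close>
  define \<epsilon> where "\<epsilon> k = 2 * (t k * norm (z k - z (k - 1)))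
    + t (Suc k) * norm (z (Suc k) - z (Suc k - 1)) + 2 * (t k * norm (G (z k) - G w))" for k
  have "\<epsilon> \<longlonglongrightarrow> 2 * 0 + 0 + 2 * 0"
    unfolding \<epsilon>_def by (intro tendsto_intros d0 g0 LIMSEQ_Suc[OF d0])
  then have \<epsilon>0: "\<epsilon> \<longlonglongrightarrow> 0" by simp
  have "(\<lambda>n. t (Suc n) * norm (B (z (Suc n) - w))) \<longlonglongrightarrow> 0"
  proof (rule averaging_recursion_tendsto_zero)
    fix n
    define k where "k = Suc n"
    have k: "1 \<le> k" by (simp add: k_def)
    have t: "1 \<le> t k" "t k \<le> t (Suc k)" "t (Suc k) \<le> t k + \<rho>"
      using t_ge_1[OF k] t_Suc_ge[OF k] t_Suc_le[OF k] by auto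
    show "0 \<le> (\<eta> - \<rho>) / t (Suc n)" "(\<eta> - \<rho>) / t (Suc n) \<le> 1"
      using t(1) strict \<rho>_pos unfolding k_def by auto
    show "0 \<le> t (Suc n) * norm (B (z (Suc n) - w))" using t(1) unfolding k_def by simp
    have "t (Suc k) *\<^sub>R B (z (Suc k) - w)
        = (t (Suc k) - \<eta>) *\<^sub>R B (z k - w) + \<eta> *\<^sub>R B (v (Suc k) - w)"
      using t by (subst B_average) (simp_all add: scaleR_add_right right_diff_distrib)
    then have "norm (t (Suc k) *\<^sub>R B (z (Suc k) - w))
        \<le> norm ((t (Suc k) - \<eta>) *\<^sub>R B (z k - w)) + norm (\<eta> *\<^sub>R B (v (Suc k) - w))"
      by (metis norm_triangle_ineq)
    then have "t (Suc k) * norm (B (z (Suc k) - w))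
        \<le> (t (Suc k) - \<eta>) * norm (B (z k - w)) + \<eta> * norm (B (v (Suc k) - w))"
      using t \<eta>_pos \<eta>_le_1 by simp
    \<comment> \<open>From \<open>t (Suc k) \<le> t k + \<rho>\<close>: the gain \<open>\<eta>\<close> of the average exceeds the growth of \<open>t\<close>.\<close>
    also have "(t (Suc k) - \<eta>) * norm (B (z k - w)) \<le> (t k - (\<eta> - \<rho>)) * norm (B (z k - w))"
      using t by (intro mult_right_mono) auto
    also have "norm (B (v (Suc k) - w)) \<le> \<epsilon> k / t k"
    proof -
      have "t k * norm (B (v (Suc k) - w)) \<le> t (Suc k) * norm (B (v (Suc k) - w))"
        using t by (intro mult_right_mono) auto
      also have "\<dots> \<le> \<epsilon> k" using scaled_v_error[OF w k] by (simp add: \<epsilon>_def B_diff)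
      finally show ?thesis using t by (simp add: field_simps)
    qed
    finally have "t (Suc k) * norm (B (z (Suc k) - w))
        \<le> (t k - (\<eta> - \<rho>)) * norm (B (z k - w)) + \<eta> * (\<epsilon> k / t k)"
      using \<eta>_pos by simp
    also have "\<dots> = (1 - (\<eta> - \<rho>) / t k) * (t k * norm (B (z k - w)))
        + (\<eta> - \<rho>) / t k * (\<eta> / (\<eta> - \<rho>) * \<epsilon> k)"
      using t strict by (simp add: field_simps)
    finally show "t (Suc (Suc n)) * norm (B (z (Suc (Suc n)) - w))
        \<le> (1 - (\<eta> - \<rho>) / t (Suc n)) * (t (Suc n) * norm (B (z (Suc n) - w)))
          + (\<eta> - \<rho>) / t (Suc n) * (\<eta> / (\<eta> - \<rho>) * \<epsilon> (Suc n))"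
      by (simp add: k_def)
  next
    show "\<not> summable (\<lambda>n. (\<eta> - \<rho>) / t (Suc n))"
      using not_summable_inverse_t[of "\<eta> - \<rho>"] summable_Suc_iff[of "\<lambda>n. (\<eta> - \<rho>) / t n"] strict by simp
    show "(\<lambda>n. \<eta> / (\<eta> - \<rho>) * \<epsilon> (Suc n)) \<longlonglongrightarrow> 0"
      by (intro tendsto_mult_right_zero LIMSEQ_Suc[OF \<epsilon>0])
  qed
  then have b0: "(\<lambda>k. t k * norm (B (z k - w))) \<longlonglongrightarrow> 0" by (rule LIMSEQ_imp_Suc)
  show "(\<lambda>k. t k * norm (G (z k) + B (z k))) \<longlonglongrightarrow> 0"
  proof (rule Lim_null_comparison)
    show "\<forall>\<^sub>F k in sequentially. norm (t k * norm (G (z k) + B (z k)))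
        \<le> t k * norm (G (z k) - G w) + t k * norm (B (z k - w))"
      using eventually_ge_at_top[of 1]
    proof eventually_elim
      case (elim k)
      have "G (z k) + B (z k) = (G (z k) - G w) + B (z k - w)"
        using w by (simp add: zeros_def B_diff algebra_simps add_eq_0_iff)
      then have "norm (G (z k) + B (z k)) \<le> norm (G (z k) - G w) + norm (B (z k - w))"
        by (metis norm_triangle_ineq)
      then have "t k * norm (G (z k) + B (z k)) \<le> t k * (norm (G (z k) - G w) + norm (B (z k - w)))"
        using t_ge_1[OF elim] by (intro mult_left_mono) auto
      then show ?case using t_ge_1[OF elim] by (simp add: abs_mult distrib_left)
    qed
    show "(\<lambda>k. t k * norm (G (z k) - G w) + t k * norm (B (z k - w))) \<longlonglongrightarrow> 0"
      using tendsto_add[OF g0 b0] by simp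
  qed
qed

end

section \<open>Gradients, tangents and saddle points\<close>

lemma GDERIV_gradient:
  fixes f :: "'a::euclidean_space \<Rightarrow> real"
  assumes "f differentiable_on UNIV"
  shows "GDERIV f p :> gradient f p"
proof -
  obtain f' where f': "(f has_derivative f') (at p)"
    using assms by (auto simp: differentiable_on_def differentiable_def)
  then have lin: "linear f'" by (rule has_derivative_linear)
  define D where "D = (\<Sum>b\<in>Basis. f' b *\<^sub>R b)"
  have "f' h = h \<bullet> D" for h
  proof -
    have "f' h = f' (\<Sum>b\<in>Basis. (h \<bullet> b) *\<^sub>R b)" by (simp add: euclidean_representation)
    also have "\<dots> = (\<Sum>b\<in>Basis. (h \<bullet> b) * f' b)"
      using lin by (simp add: linear_sum linear_scale)
    also have "\<dots> = h \<bullet> D" by (simp add: D_def inner_sum_right mult.commute)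
    finally show ?thesis .
  qed
  then have D: "GDERIV f p :> D"
    using f' by (simp add: gderiv_def flip: fun_eq_iff) (metis (no_types, lifting) ext)
  moreover have "D' = D" if "GDERIV f p :> D'" for D'
  proof -
    have "(\<lambda>h. h \<bullet> D') = (\<lambda>h. h \<bullet> D)"
      using that D has_derivative_unique unfolding gderiv_def by blast
    then show ?thesis by (metis inner_commute vector_eq_ldot)
  qed
  ultimately show ?thesis
    unfolding gradient_def by (rule theI)
qed

lemma DERIV_along_line:
  assumes "\<And>p. GDERIV f p :> G p"
  shows "((\<lambda>\<tau>. f (p + \<tau> *\<^sub>R h)) has_real_derivative G (p + \<tau> *\<^sub>R h) \<bullet> h) (at \<tau>)"
proof -
  have "((\<lambda>\<tau>. p + \<tau> *\<^sub>R h) has_derivative (\<lambda>d. d *\<^sub>R h)) (at \<tau>)"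
    by (auto intro!: derivative_eq_intros)
  from has_derivative_compose[OF this assms[unfolded gderiv_def]] show ?thesis
    unfolding has_field_derivative_def
    by (rule has_derivative_eq_rhs) (simp add: fun_eq_iff inner_commute)
qed

lemma convex_above_tangent:
  assumes conv: "convex_on UNIV f" and G: "\<And>p. GDERIV f p :> G p"
  shows "f q + G q \<bullet> (p - q) \<le> f p"
proof -
  define \<phi> where "\<phi> \<tau> = f (q + \<tau> *\<^sub>R (p - q))" for \<tau> :: real
  have "convex_on UNIV \<phi>"
  proof (rule convex_onI)
    fix \<mu> a b :: real assume "0 < \<mu>" "\<mu> < 1"
    moreover have "q + ((1 - \<mu>) * a + \<mu> * b) *\<^sub>R (p - q)
        = (1 - \<mu>) *\<^sub>R (q + a *\<^sub>R (p - q)) + \<mu> *\<^sub>R (q + b *\<^sub>R (p - q))"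
      by (simp add: algebra_simps)
    ultimately show "\<phi> ((1 - \<mu>) *\<^sub>R a + \<mu> *\<^sub>R b) \<le> (1 - \<mu>) * \<phi> a + \<mu> * \<phi> b"
      using convex_onD[OF conv, of \<mu>] by (simp add: \<phi>_def)
  qed simp
  moreover have "(\<phi> has_real_derivative G q \<bullet> (p - q)) (at 0)"
    using DERIV_along_line[OF G, of q "p - q" 0] by (simp add: \<phi>_def[abs_def])
  ultimately have "\<phi> 1 - \<phi> 0 \<ge> G q \<bullet> (p - q) * (1 - 0)"
    by (intro convex_on_imp_above_tangent[where A = UNIV]) auto
  then show ?thesis by (simp add: \<phi>_def)
qed

lemma descent_lemma:
  assumes lip: "L-lipschitz_on UNIV G" and G: "\<And>p. GDERIV f p :> G p"
  shows "f p \<le> f q + G q \<bullet> (p - q) + L / 2 * (norm (p - q))\<^sup>2"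
proof -
  define h where "h = p - q"
  define \<psi> where "\<psi> \<tau> = f (q + \<tau> *\<^sub>R h) - \<tau> * (G q \<bullet> h) - L / 2 * \<tau>\<^sup>2 * (norm h)\<^sup>2" for \<tau> :: real
  have "\<psi> 1 \<le> \<psi> 0"
  proof (rule DERIV_nonpos_imp_nonincreasing[where f = \<psi> and a = 0 and b = 1])
    fix \<tau> :: real assume "0 \<le> \<tau>" "\<tau> \<le> 1"
    have "(\<psi> has_real_derivative G (q + \<tau> *\<^sub>R h) \<bullet> h - G q \<bullet> h - L * \<tau> * (norm h)\<^sup>2) (at \<tau>)"
      unfolding \<psi>_def by (auto intro!: derivative_eq_intros DERIV_along_line[OF G])
    moreover have "(G (q + \<tau> *\<^sub>R h) - G q) \<bullet> h \<le> L * \<tau> * (norm h)\<^sup>2"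
    proof -
      have "(G (q + \<tau> *\<^sub>R h) - G q) \<bullet> h \<le> norm (G (q + \<tau> *\<^sub>R h) - G q) * norm h"
        by (rule norm_cauchy_schwarz)
      also have "norm (G (q + \<tau> *\<^sub>R h) - G q) \<le> L * (\<tau> * norm h)"
        using lipschitz_onD[OF lip, of "q + \<tau> *\<^sub>R h" q] \<open>0 \<le> \<tau>\<close> by (simp add: dist_norm)
      finally show ?thesis by (simp add: power2_eq_square mult_right_mono algebra_simps)
    qed
    ultimately show "\<exists>y. (\<psi> has_real_derivative y) (at \<tau>) \<and> y \<le> 0"
      by (auto simp: inner_diff_left)
  qed simp
  then show ?thesis by (simp add: \<psi>_def h_def)
qed

lemma GDERIV_at_minimizer_zero:
  assumes G: "\<And>p. GDERIV f p :> G p" and min: "\<And>p. f q \<le> f p"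
  shows "G q = 0"
proof -
  have "G q \<bullet> G q = 0"
    using DERIV_local_min[OF DERIV_along_line[OF G, of q "G q" 0], of 1] min by simp
  then show ?thesis by simp
qed

lemma inner_transpose_matrix:
  fixes K :: "real^'n^'m"
  shows "(transpose K *v p) \<bullet> q = p \<bullet> (K *v q)"
    and "q \<bullet> (transpose K *v p) = (K *v q) \<bullet> p"
  by (metis dot_lmul_matrix transpose_matrix_vector inner_commute)+

lemma saddle_points_lagrangian:
  fixes f :: "real^'n \<Rightarrow> real" and g :: "real^'m \<Rightarrow> real"
  assumes f: "convex_on UNIV f" "\<And>p. GDERIV f p :> Gf p"
    and g: "convex_on UNIV g" "\<And>p. GDERIV g p :> Gg p"
  shows "(a, b) \<in> saddle_points (lagrangian f g K)
    \<longleftrightarrow> Gf a + transpose K *v b = 0 \<and> Gg b - K *v a = 0"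
proof
  assume saddle: "(a, b) \<in> saddle_points (lagrangian f g K)"
  have "GDERIV (\<lambda>p. lagrangian f g K p b) p :> Gf p + transpose K *v b" for p
  proof -
    have "GDERIV (\<lambda>p. (K *v p) \<bullet> b) p :> transpose K *v b"
      unfolding gderiv_def
      by (auto intro!: derivative_eq_intros bounded_linear_imp_has_derivative[OF matrix_vector_mul_bounded_linear]
          simp: inner_transpose_matrix simp del: transpose_matrix_vector)
    then show ?thesis
      unfolding lagrangian_def using GDERIV_diff[OF GDERIV_add[OF f(2)] GDERIV_const] by fastforce
  qed
  then have 1: "Gf a + transpose K *v b = 0"
    by (rule GDERIV_at_minimizer_zero) (use saddle in \<open>auto simp: saddle_points_def\<close>)
  have "GDERIV (\<lambda>p. - lagrangian f g K a p) p :> Gg p - K *v a" for p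
  proof -
    have "GDERIV (\<lambda>p. (K *v a) \<bullet> p) p :> K *v a"
      unfolding gderiv_def
      by (auto intro!: derivative_eq_intros simp: inner_commute)
    then have "GDERIV (\<lambda>p. f a + (K *v a) \<bullet> p - g p) p :> 0 + K *v a - Gg p"
      by (intro GDERIV_diff GDERIV_add GDERIV_const g(2))
    from GDERIV_minus[OF this] show ?thesis unfolding lagrangian_def by simp
  qed
  then have "Gg b - K *v a = 0"
    by (rule GDERIV_at_minimizer_zero) (use saddle in \<open>auto simp: saddle_points_def\<close>)
  with 1 show "Gf a + transpose K *v b = 0 \<and> Gg b - K *v a = 0" by simp
next
  assume stationary: "Gf a + transpose K *v b = 0 \<and> Gg b - K *v a = 0"
  have "lagrangian f g K a q \<le> lagrangian f g K a b" for q
    using convex_above_tangent[OF g, of b q] stationary by (simp add: lagrangian_def inner_diff_right)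
  moreover have "lagrangian f g K a b \<le> lagrangian f g K p b" for p
  proof -
    have "Gf a \<bullet> (p - a) = - ((transpose K *v b) \<bullet> (p - a))"
      using stationary by (simp add: add_eq_0_iff2)
    also have "\<dots> = (K *v a) \<bullet> b - (K *v p) \<bullet> b"
      by (simp add: inner_transpose_matrix matrix_vector_mult_diff_distrib inner_diff_right
          inner_commute[of b] del: transpose_matrix_vector)
    finally show ?thesis
      using convex_above_tangent[OF f, of a p] by (simp add: lagrangian_def)
  qed
  ultimately show "(a, b) \<in> saddle_points (lagrangian f g K)" by (simp add: saddle_points_def)
qed

text \<open>
The first-order condition of the quadratic subproblem. The penalty term and the linear term combine, through the
dual update, into the new dual iterate: this is why the two updates
form one step that is implicit in \<open>B\<close>.
\<close>

lemma primal_objective_minimizer: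
  fixes f :: "real^'n \<Rightarrow> real" and g :: "real^'m \<Rightarrow> real"
  assumes min: "is_arg_min (primal_objective f g K r s a c xk yk xb yb) (\<lambda>_. True) x'"
    and y': "y' = yb - s *\<^sub>R gradient g yb + s *\<^sub>R (K *v (c *\<^sub>R x' - a *\<^sub>R xk))"
    and "0 < r"
  shows "x' = xb - r *\<^sub>R (gradient f xb + transpose K *v (c *\<^sub>R y' - a *\<^sub>R yk))"
proof -
  define b where "b = c *\<^sub>R (yb - s *\<^sub>R gradient g yb) - a *\<^sub>R yk"
  have "GDERIV (primal_objective f g K r s a c xk yk xb yb) u :>
      (1 / r) *\<^sub>R (u - xb) + gradient f xb
        + transpose K *v (b + (s * c) *\<^sub>R (c *\<^sub>R (K *v u) - a *\<^sub>R (K *v xk)))" for u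
    unfolding gderiv_def primal_objective_def b_def[symmetric] power2_norm_eq_inner
    using \<open>0 < r\<close>
    by (auto intro!: derivative_eq_intros bounded_linear_imp_has_derivative[OF matrix_vector_mul_bounded_linear]
        simp: inner_transpose_matrix inner_simps fun_eq_iff inner_commute algebra_simps
        simp del: transpose_matrix_vector)
  then have "(1 / r) *\<^sub>R (x' - xb) + gradient f xb
        + transpose K *v (b + (s * c) *\<^sub>R (c *\<^sub>R (K *v x') - a *\<^sub>R (K *v xk))) = 0"
    by (rule GDERIV_at_minimizer_zero) (use min in \<open>auto simp: is_arg_min_def not_less\<close>)
  moreover have "b + (s * c) *\<^sub>R (c *\<^sub>R (K *v x') - a *\<^sub>R (K *v xk)) = c *\<^sub>R y' - a *\<^sub>R yk"
    unfolding y' b_def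
    by (simp add: matrix_vector_mult_diff_distrib matrix_vector_mult_scaleR algebra_simps)
  ultimately have "(1 / r) *\<^sub>R (x' - xb) + (gradient f xb + transpose K *v (c *\<^sub>R y' - a *\<^sub>R yk)) = 0"
    by (simp only: add.assoc)
  then have "(1 / r) *\<^sub>R (x' - xb) = - (gradient f xb + transpose K *v (c *\<^sub>R y' - a *\<^sub>R yk))"
    by (rule eq_neg_iff_add_eq_0[THEN iffD2])
  from arg_cong[OF this, of "scaleR r"] \<open>0 < r\<close>
  have "x' - xb = - (r *\<^sub>R (gradient f xb + transpose K *v (c *\<^sub>R y' - a *\<^sub>R yk)))"
    by (simp add: algebra_simps del: transpose_matrix_vector)
  then show ?thesis by (simp only: diff_eq_eq) simp
qed

section \<open>Rescaling the primal-dual iteration\<close>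

definition scale_pair :: "real \<Rightarrow> real \<Rightarrow> 'a::real_vector \<times> 'b::real_vector \<Rightarrow> 'a \<times> 'b" where
  "scale_pair a b p = (a *\<^sub>R fst p, b *\<^sub>R snd p)"

lemma norm_scale_pair_le:
  fixes p :: "'a::real_normed_vector \<times> 'b::real_normed_vector"
  shows "norm (scale_pair a b p) \<le> (\<bar>a\<bar> + \<bar>b\<bar>) * norm p"
proof -
  have "norm (scale_pair a b p) \<le> \<bar>a\<bar> * norm (fst p) + \<bar>b\<bar> * norm (snd p)"
    using norm_Pair_le[of "a *\<^sub>R fst p" "b *\<^sub>R snd p"] by (simp add: scale_pair_def)
  also have "\<dots> \<le> \<bar>a\<bar> * norm p + \<bar>b\<bar> * norm p"
    using norm_fst_le[of "fst p" "snd p"] norm_snd_le[of "snd p" "fst p"]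
    by (intro add_mono mult_left_mono) auto
  finally show ?thesis by (simp add: distrib_right)
qed

lemma rescaled_smooth_convex_skew:
  fixes f :: "real^'n \<Rightarrow> real" and g :: "real^'m \<Rightarrow> real" and K :: "real^'n^'m"
  assumes f: "convex_on UNIV f" "\<And>p. GDERIV f p :> Gf p" "L\<^sub>f-lipschitz_on UNIV Gf" "a\<^sup>2 * L\<^sub>f \<le> 1"
    and g: "convex_on UNIV g" "\<And>p. GDERIV g p :> Gg p" "L\<^sub>g-lipschitz_on UNIV Gg" "b\<^sup>2 * L\<^sub>g \<le> 1"
  shows "smooth_convex_skew (\<lambda>p. f (a *\<^sub>R fst p) + g (b *\<^sub>R snd p))
    (\<lambda>p. (a *\<^sub>R Gf (a *\<^sub>R fst p), b *\<^sub>R Gg (b *\<^sub>R snd p)))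
    (\<lambda>p. (a * b) *\<^sub>R (transpose K *v snd p, - (K *v fst p)))"
proof (rule smooth_convex_skew.intro)
  fix p q :: "(real^'n) \<times> (real^'m)"
  obtain p\<^sub>1 p\<^sub>2 q\<^sub>1 q\<^sub>2 where [simp]: "p = (p\<^sub>1, p\<^sub>2)" "q = (q\<^sub>1, q\<^sub>2)" by fastforce
  show "f (a *\<^sub>R fst q) + g (b *\<^sub>R snd q)
      + (a *\<^sub>R Gf (a *\<^sub>R fst q), b *\<^sub>R Gg (b *\<^sub>R snd q)) \<bullet> (p - q)
      \<le> f (a *\<^sub>R fst p) + g (b *\<^sub>R snd p)"
    using convex_above_tangent[OF f(1,2), of "a *\<^sub>R q\<^sub>1" "a *\<^sub>R p\<^sub>1"]
      convex_above_tangent[OF g(1,2), of "b *\<^sub>R q\<^sub>2" "b *\<^sub>R p\<^sub>2"]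
    by (simp flip: scaleR_diff_right)
  have "f (a *\<^sub>R p\<^sub>1) \<le> f (a *\<^sub>R q\<^sub>1) + (a *\<^sub>R Gf (a *\<^sub>R q\<^sub>1)) \<bullet> (p\<^sub>1 - q\<^sub>1) + (norm (p\<^sub>1 - q\<^sub>1))\<^sup>2 / 2"
    using descent_lemma[OF f(3,2), of "a *\<^sub>R p\<^sub>1" "a *\<^sub>R q\<^sub>1"]
      mult_right_mono[OF f(4), of "(norm (p\<^sub>1 - q\<^sub>1))\<^sup>2 / 2"]
    by (simp add: power_mult_distrib mult_ac flip: scaleR_diff_right)
  moreover have "g (b *\<^sub>R p\<^sub>2) \<le> g (b *\<^sub>R q\<^sub>2) + (b *\<^sub>R Gg (b *\<^sub>R q\<^sub>2)) \<bullet> (p\<^sub>2 - q\<^sub>2) + (norm (p\<^sub>2 - q\<^sub>2))\<^sup>2 / 2"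
    using descent_lemma[OF g(3,2), of "b *\<^sub>R p\<^sub>2" "b *\<^sub>R q\<^sub>2"]
      mult_right_mono[OF g(4), of "(norm (p\<^sub>2 - q\<^sub>2))\<^sup>2 / 2"]
    by (simp add: power_mult_distrib mult_ac flip: scaleR_diff_right)
  moreover have "(norm (p - q))\<^sup>2 = (norm (p\<^sub>1 - q\<^sub>1))\<^sup>2 + (norm (p\<^sub>2 - q\<^sub>2))\<^sup>2"
    by (simp add: norm_Pair)
  ultimately show "f (a *\<^sub>R fst p) + g (b *\<^sub>R snd p) \<le> f (a *\<^sub>R fst q) + g (b *\<^sub>R snd q)
      + (a *\<^sub>R Gf (a *\<^sub>R fst q), b *\<^sub>R Gg (b *\<^sub>R snd q)) \<bullet> (p - q) + (norm (p - q))\<^sup>2 / 2"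
    by (simp add: add_divide_distrib)
  show "((a * b) *\<^sub>R (transpose K *v snd p, - (K *v fst p))) \<bullet> p = 0"
    by (simp add: inner_transpose_matrix inner_commute del: transpose_matrix_vector)
next
  show "linear (\<lambda>p. (a * b) *\<^sub>R (transpose K *v snd p, - (K *v fst p)) :: (real^'n) \<times> (real^'m))"
    by (rule linearI) (simp_all add: matrix_vector_right_distrib matrix_vector_mult_scaleR
        algebra_simps del: transpose_matrix_vector)
qed

text \<open>
At a stationary point the gradients are \<open>- transpose K *v v\<^sub>0\<close> and \<open>K *v u\<^sub>0\<close>, so the two coupling terms
of the gap are exactly the linear part of the Bregman distance.
\<close>

lemma lagrangian_gap_eq_bregman:
  fixes f :: "real^'n \<Rightarrow> real" and g :: "real^'m \<Rightarrow> real"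
  assumes "Gf u\<^sub>0 + transpose K *v v\<^sub>0 = 0" "Gg v\<^sub>0 - K *v u\<^sub>0 = 0"
  shows "lagrangian f g K u v\<^sub>0 - lagrangian f g K u\<^sub>0 v
    = (f u + g v) - (f u\<^sub>0 + g v\<^sub>0) - (Gf u\<^sub>0 \<bullet> (u - u\<^sub>0) + Gg v\<^sub>0 \<bullet> (v - v\<^sub>0))"
proof -
  have "Gf u\<^sub>0 = - (transpose K *v v\<^sub>0)" "Gg v\<^sub>0 = K *v u\<^sub>0"
    using assms by (simp_all add: eq_neg_iff_add_eq_0)
  then show ?thesis
    by (simp add: lagrangian_def inner_transpose_matrix inner_diff_right matrix_vector_mult_diff_distrib
        inner_commute[of v\<^sub>0] del: transpose_matrix_vector)
qed

theorem theorem4p3: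
  fixes f :: "real^'n \<Rightarrow> real" and g :: "real^'m \<Rightarrow> real" and K :: "real^'n^'m"
    and L\<^sub>f L\<^sub>g r s \<rho> \<eta> :: real
    and t :: "nat \<Rightarrow> real" and x :: "nat \<Rightarrow> real^'n" and y :: "nat \<Rightarrow> real^'m"
  defines "L \<equiv> lagrangian f g K"
  assumes "convex_on UNIV f" and "f differentiable_on UNIV"
    and "convex_on UNIV g" and "g differentiable_on UNIV"
    and "L\<^sub>f > 0" and "L\<^sub>f-lipschitz_on UNIV (gradient f)"
    and "L\<^sub>g > 0" and "L\<^sub>g-lipschitz_on UNIV (gradient g)"
    and "saddle_points L \<noteq> {}"
    and "0 < r" and "r \<le> 1 / L\<^sub>f" and "0 < s" and "s \<le> 1 / L\<^sub>g"
    and "0 < \<rho>" and "\<rho> \<le> 1" and "\<rho> \<le> \<eta>" and "\<eta> \<le> 1"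
    and "mono_on {1..} t" and "t 1 = 1" and "filterlim t at_top sequentially"
    and "\<And>k. k \<ge> 1 \<Longrightarrow> (t (k + 1))\<^sup>2 \<le> (t k)\<^sup>2 + \<rho> * t (k + 1)"
    and "fast_primal_dual f g K r s \<eta> t x y"
  shows
    "(\<forall>(xs, ys) \<in> saddle_points L.
        (\<lambda>k. L (x k) ys - L xs (y k)) \<in> O(\<lambda>k. 1 / (t k)\<^sup>2) \<and>
        (\<lambda>k. norm ((x k, y k) - (x (k - 1), y (k - 1)))) \<in> O(\<lambda>k. 1 / t k))
     \<and>
     (\<exists>(xs, ys) \<in> saddle_points L.
        (\<lambda>k. (x k, y k)) \<longlonglongrightarrow> (xs, ys) \<and>
        (\<rho> < \<eta> \<and> \<eta> < 1 \<longrightarrow>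
           (\<lambda>k. L (x k) ys - L xs (y k)) \<in> o(\<lambda>k. 1 / (t k)\<^sup>2) \<and>
           (\<lambda>k. norm ((x k, y k) - (x (k - 1), y (k - 1)))) \<in> o(\<lambda>k. 1 / t k) \<and>
           (\<lambda>k. norm (gradient f (x k) + transpose K *v y k, gradient g (y k) - K *v x k))
             \<in> o(\<lambda>k. 1 / t k)))"
proof -
  note [simp del] = transpose_matrix_vector
  \<comment> \<open>In the coordinates \<open>x / sqrt r\<close> and \<open>y / sqrt s\<close> both steps have length 1.\<close>
  define a b where "a = sqrt r" and "b = sqrt s"
  have ab: "0 < a" "0 < b" and sq: "a * a = r" "b * b = s"
    using \<open>0 < r\<close> \<open>0 < s\<close> by (simp_all add: a_def b_def)
  have Gf: "GDERIV f p :> gradient f p" and Gg: "GDERIV g q :> gradient g q" for p q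
    using GDERIV_gradient \<open>f differentiable_on UNIV\<close> \<open>g differentiable_on UNIV\<close> by blast+
  define F where "F p = f (a *\<^sub>R fst p) + g (b *\<^sub>R snd p)" for p
  define G where "G p = (a *\<^sub>R gradient f (a *\<^sub>R fst p), b *\<^sub>R gradient g (b *\<^sub>R snd p))" for p
  define B where "B p = (a * b) *\<^sub>R (transpose K *v snd p, - (K *v fst p))" for p
  define z where "z k = scale_pair (1 / a) (1 / b) (x k, y k)" for k
  have z: "a *\<^sub>R fst (z k) = x k" "b *\<^sub>R snd (z k) = y k" for k
    using ab by (simp_all add: z_def scale_pair_def)
  have "a\<^sup>2 * L\<^sub>f \<le> 1" "b\<^sup>2 * L\<^sub>g \<le> 1"
    using \<open>r \<le> 1 / L\<^sub>f\<close> \<open>s \<le> 1 / L\<^sub>g\<close> \<open>L\<^sub>f > 0\<close> \<open>L\<^sub>g > 0\<close> by (simp_all add: power2_eq_square sq field_simps)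
  then have scs: "smooth_convex_skew F G B"
    unfolding F_def[abs_def] G_def[abs_def] B_def[abs_def]
    using rescaled_smooth_convex_skew[OF \<open>convex_on UNIV f\<close> Gf \<open>L\<^sub>f-lipschitz_on UNIV (gradient f)\<close> _
        \<open>convex_on UNIV g\<close> Gg \<open>L\<^sub>g-lipschitz_on UNIV (gradient g)\<close>] by blast
  have step: "z (Suc k) = extrapolate t z k - G (extrapolate t z k)
      - B (z k + (t (Suc k) / \<eta>) *\<^sub>R (z (Suc k) - z k))" if k: "1 \<le> k" for k
  proof -
    define \<tau> where "\<tau> = t (Suc k) / \<eta>"
    define xb yb where "xb = extrapolate t x k" and "yb = extrapolate t y k"
    have c: "coeff_c \<eta> t k = \<tau>" and a': "coeff_a \<eta> t k = \<tau> - 1"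
      using \<open>0 < \<rho>\<close> \<open>\<rho> \<le> \<eta>\<close> by (simp_all add: coeff_c_def coeff_a_def \<tau>_def diff_divide_distrib)
    have "is_arg_min (primal_objective f g K r s (coeff_a \<eta> t k) (coeff_c \<eta> t k) (x k) (y k) xb yb)
          (\<lambda>_. True) (x (Suc k))
        \<and> y (Suc k) = yb - s *\<^sub>R gradient g yb
            + s *\<^sub>R (K *v (coeff_c \<eta> t k *\<^sub>R x (Suc k) - coeff_a \<eta> t k *\<^sub>R x k))"
      using \<open>fast_primal_dual f g K r s \<eta> t x y\<close> k
      by (simp add: fast_primal_dual_def Let_def xb_def yb_def)
    then have min: "is_arg_min (primal_objective f g K r s (\<tau> - 1) \<tau> (x k) (y k) xb yb) (\<lambda>_. True) (x (Suc k))"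
      and y': "y (Suc k) = yb - s *\<^sub>R gradient g yb + s *\<^sub>R (K *v (\<tau> *\<^sub>R x (Suc k) - (\<tau> - 1) *\<^sub>R x k))"
      unfolding c a' by simp_all
    have x': "x (Suc k) = xb - r *\<^sub>R (gradient f xb + transpose K *v (\<tau> *\<^sub>R y (Suc k) - (\<tau> - 1) *\<^sub>R y k))"
      by (rule primal_objective_minimizer[OF min y' \<open>0 < r\<close>])
    have zb: "extrapolate t z k = scale_pair (1 / a) (1 / b) (xb, yb)"
      by (simp add: extrapolate_def z_def scale_pair_def xb_def yb_def algebra_simps)
    have "z k + \<tau> *\<^sub>R (z (Suc k) - z k) = scale_pair (1 / a) (1 / b)
        (\<tau> *\<^sub>R x (Suc k) - (\<tau> - 1) *\<^sub>R x k, \<tau> *\<^sub>R y (Suc k) - (\<tau> - 1) *\<^sub>R y k)"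
      by (simp add: z_def scale_pair_def algebra_simps)
    then have Bv: "B (z k + \<tau> *\<^sub>R (z (Suc k) - z k))
        = (a *\<^sub>R (transpose K *v (\<tau> *\<^sub>R y (Suc k) - (\<tau> - 1) *\<^sub>R y k)),
           - (b *\<^sub>R (K *v (\<tau> *\<^sub>R x (Suc k) - (\<tau> - 1) *\<^sub>R x k))))"
      using ab by (simp only:) (simp add: B_def scale_pair_def matrix_vector_mult_scaleR)
    have "(1 / a) *\<^sub>R x (Suc k) = (1 / a) *\<^sub>R xb - a *\<^sub>R gradient f xb
        - a *\<^sub>R (transpose K *v (\<tau> *\<^sub>R y (Suc k) - (\<tau> - 1) *\<^sub>R y k))"
      using ab by (subst x') (simp add: scaleR_diff_right scaleR_add_right flip: sq)
    moreover have "(1 / b) *\<^sub>R y (Suc k) = (1 / b) *\<^sub>R yb - b *\<^sub>R gradient g yb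
        + b *\<^sub>R (K *v (\<tau> *\<^sub>R x (Suc k) - (\<tau> - 1) *\<^sub>R x k))"
      using ab by (subst y') (simp add: scaleR_diff_right scaleR_add_right flip: sq)
    ultimately show ?thesis
      unfolding \<tau>_def[symmetric] Bv zb using ab by (simp add: z_def scale_pair_def G_def)
  qed
  interpret smooth_convex_skew F G B by (rule scs)
  interpret fast_skew_gradient F G B t z \<rho> \<eta>
  proof
    show "t k \<le> t (Suc k)" if "1 \<le> k" for k
      using \<open>mono_on {1..} t\<close> that by (auto intro: mono_onD)
    show "(t (Suc k))\<^sup>2 \<le> (t k)\<^sup>2 + \<rho> * t (Suc k)" if "1 \<le> k" for k
      using assms(22)[OF that] by simp
  qed (fact | rule step)+
  \<comment> \<open>The optimality residuals in the two coordinate systems differ by the scaling only.\<close>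
  have residual: "G w + B w = scale_pair a b
      (gradient f (a *\<^sub>R fst w) + transpose K *v (b *\<^sub>R snd w), gradient g (b *\<^sub>R snd w) - K *v (a *\<^sub>R fst w))" for w
    by (simp add: G_def B_def scale_pair_def matrix_vector_mult_scaleR algebra_simps)
  have saddle: "(xs, ys) \<in> saddle_points L
      \<longleftrightarrow> gradient f xs + transpose K *v ys = 0 \<and> gradient g ys - K *v xs = 0" for xs ys
    unfolding L_def using saddle_points_lagrangian[OF \<open>convex_on UNIV f\<close> Gf \<open>convex_on UNIV g\<close> Gg] .
  have zeros: "w \<in> zeros \<longleftrightarrow> (a *\<^sub>R fst w, b *\<^sub>R snd w) \<in> saddle_points L" for w
    unfolding saddle zeros_def mem_Collect_eq residual using ab by (simp add: scale_pair_def prod_eq_iff)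
  have gap: "L (x k) (b *\<^sub>R snd w) - L (a *\<^sub>R fst w) (y k) = bregman (z k) w" if "w \<in> zeros" for w k
  proof -
    have st: "gradient f (a *\<^sub>R fst w) + transpose K *v (b *\<^sub>R snd w) = 0"
      "gradient g (b *\<^sub>R snd w) - K *v (a *\<^sub>R fst w) = 0"
      using that unfolding zeros saddle by auto
    have "G w \<bullet> (z k - w) = gradient f (a *\<^sub>R fst w) \<bullet> (x k - a *\<^sub>R fst w)
        + gradient g (b *\<^sub>R snd w) \<bullet> (y k - b *\<^sub>R snd w)"
      by (simp add: G_def inner_prod_def scaleR_diff_right inner_diff_right flip: z)
    then show ?thesis
      unfolding L_def lagrangian_gap_eq_bregman[where Gf = "gradient f" and Gg = "gradient g", OF st] bregman_def by (simp add: F_def z)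
  qed
  define M where "M = a + b"
  have increment: "norm ((x k, y k) - (x (k - 1), y (k - 1))) \<le> M * norm (z k - z (k - 1))" for k
    using norm_scale_pair_le[of a b "z k - z (k - 1)"] ab
    by (simp add: scale_pair_def scaleR_diff_right z M_def)
  have "0 < M" using ab by (simp add: M_def)
  have t_pos: "\<forall>\<^sub>F k in sequentially. 0 < t k"
    using \<open>filterlim t at_top sequentially\<close> by (auto simp: filterlim_at_top_dense)
  have littleo: "h \<in> o(\<lambda>k. 1 / c k)"
    if "(\<lambda>k. c k * h k) \<longlonglongrightarrow> 0" "\<forall>\<^sub>F k in sequentially. 0 < c k" for h c :: "nat \<Rightarrow> real"
    by (rule smalloI_tendsto) (use that in \<open>auto simp: mult.commute elim: eventually_mono\<close>)
  have dominated: "(\<lambda>k. t k * h k) \<longlonglongrightarrow> 0"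
    if "(\<lambda>k. t k * d k) \<longlonglongrightarrow> 0" "\<And>k. 0 \<le> h k" "\<And>k. h k \<le> N * d k" for h d :: "nat \<Rightarrow> real" and N
  proof (rule Lim_null_comparison)
    show "(\<lambda>k. N * (t k * d k)) \<longlonglongrightarrow> 0" using that(1) by (rule tendsto_mult_right_zero)
    show "\<forall>\<^sub>F k in sequentially. norm (t k * h k) \<le> N * (t k * d k)"
      using t_pos
    proof eventually_elim
      case (elim k)
      then show ?case using mult_left_mono[OF that(3)[of k], of "t k"] that(2)[of k]
        by (simp add: abs_mult mult.left_commute)
    qed
  qed
  have "\<forall>(xs, ys) \<in> saddle_points L.
        (\<lambda>k. L (x k) ys - L xs (y k)) \<in> O(\<lambda>k. 1 / (t k)\<^sup>2) \<and>
        (\<lambda>k. norm ((x k, y k) - (x (k - 1), y (k - 1)))) \<in> O(\<lambda>k. 1 / t k)"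
  proof (intro ballI, clarify)
    fix xs ys assume s: "(xs, ys) \<in> saddle_points L"
    define w where "w = scale_pair (1 / a) (1 / b) (xs, ys)"
    have w_eq: "a *\<^sub>R fst w = xs" "b *\<^sub>R snd w = ys" using ab by (simp_all add: w_def scale_pair_def)
    have w: "w \<in> zeros" unfolding zeros w_eq by (rule s)
    obtain C where D: "\<And>k. 1 \<le> k \<Longrightarrow> (t k)\<^sup>2 * bregman (z k) w \<le> C"
      and I: "\<And>k. 1 \<le> k \<Longrightarrow> t k * norm (z k - z (k - 1)) \<le> C"
      using iterate_bounds[OF w] by metis
    have "(\<lambda>k. L (x k) ys - L xs (y k)) \<in> O(\<lambda>k. 1 / (t k)\<^sup>2)"
    proof (rule bigoI)
      show "\<forall>\<^sub>F k in sequentially. norm (L (x k) ys - L xs (y k)) \<le> C * norm (1 / (t k)\<^sup>2)"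
        using eventually_ge_at_top[of 1]
      proof eventually_elim
        case (elim k)
        then show ?case
          using gap[OF w, of k] D[OF elim] t_ge_1[OF elim] bregman_nonneg[of "z k" w]
          by (simp add: w_eq field_simps)
      qed
    qed
    moreover have "(\<lambda>k. norm ((x k, y k) - (x (k - 1), y (k - 1)))) \<in> O(\<lambda>k. 1 / t k)"
    proof (rule bigoI)
      show "\<forall>\<^sub>F k in sequentially. norm (norm ((x k, y k) - (x (k - 1), y (k - 1)))) \<le> M * C * norm (1 / t k)"
        using eventually_ge_at_top[of 1]
      proof eventually_elim
        case (elim k)
        have "norm (z k - z (k - 1)) \<le> C / t k"
          using I[OF elim] t_ge_1[OF elim] by (simp add: field_simps)
        then have "M * norm (z k - z (k - 1)) \<le> M * (C / t k)"
          using \<open>0 < M\<close> by (intro mult_left_mono) auto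
        then have "norm ((x k, y k) - (x (k - 1), y (k - 1))) \<le> M * (C / t k)"
          using increment[of k] by linarith
        then show ?case using t_ge_1[OF elim] by simp
      qed
    qed
    ultimately show "(\<lambda>k. L (x k) ys - L xs (y k)) \<in> O(\<lambda>k. 1 / (t k)\<^sup>2) \<and>
        (\<lambda>k. norm ((x k, y k) - (x (k - 1), y (k - 1)))) \<in> O(\<lambda>k. 1 / t k)" ..
  qed
  moreover have "\<exists>(xs, ys) \<in> saddle_points L.
        (\<lambda>k. (x k, y k)) \<longlonglongrightarrow> (xs, ys) \<and>
        (\<rho> < \<eta> \<and> \<eta> < 1 \<longrightarrow>
           (\<lambda>k. L (x k) ys - L xs (y k)) \<in> o(\<lambda>k. 1 / (t k)\<^sup>2) \<and>
           (\<lambda>k. norm ((x k, y k) - (x (k - 1), y (k - 1)))) \<in> o(\<lambda>k. 1 / t k) \<and>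
           (\<lambda>k. norm (gradient f (x k) + transpose K *v y k, gradient g (y k) - K *v x k))
             \<in> o(\<lambda>k. 1 / t k))"
  proof -
    obtain xs ys where s: "(xs, ys) \<in> saddle_points L" using \<open>saddle_points L \<noteq> {}\<close> by fast
    have "scale_pair (1 / a) (1 / b) (xs, ys) \<in> zeros"
      unfolding zeros using s ab by (simp add: scale_pair_def)
    then obtain w where w: "w \<in> zeros" and lim: "z \<longlonglongrightarrow> w" using iterates_converge by blast
    have "(\<lambda>k. (a *\<^sub>R fst (z k), b *\<^sub>R snd (z k))) \<longlonglongrightarrow> (a *\<^sub>R fst w, b *\<^sub>R snd w)"
      by (intro tendsto_intros lim)
    then have conv: "(\<lambda>k. (x k, y k)) \<longlonglongrightarrow> (a *\<^sub>R fst w, b *\<^sub>R snd w)" by (simp add: z)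
    have "(\<lambda>k. L (x k) (b *\<^sub>R snd w) - L (a *\<^sub>R fst w) (y k)) \<in> o(\<lambda>k. 1 / (t k)\<^sup>2) \<and>
        (\<lambda>k. norm ((x k, y k) - (x (k - 1), y (k - 1)))) \<in> o(\<lambda>k. 1 / t k) \<and>
        (\<lambda>k. norm (gradient f (x k) + transpose K *v y k, gradient g (y k) - K *v x k))
          \<in> o(\<lambda>k. 1 / t k)" if strict: "\<rho> < \<eta>" "\<eta> < 1"
    proof (intro conjI)
      note rates = fast_rates[OF w lim strict]
      show "(\<lambda>k. L (x k) (b *\<^sub>R snd w) - L (a *\<^sub>R fst w) (y k)) \<in> o(\<lambda>k. 1 / (t k)\<^sup>2)"
        unfolding gap[OF w]
        by (rule littleo[OF rates(1)]) (use t_pos in \<open>auto elim: eventually_mono\<close>)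
      show "(\<lambda>k. norm ((x k, y k) - (x (k - 1), y (k - 1)))) \<in> o(\<lambda>k. 1 / t k)"
        by (rule littleo[OF dominated[OF rates(2) norm_ge_zero increment] t_pos])
      have "norm (gradient f (x k) + transpose K *v y k, gradient g (y k) - K *v x k)
          \<le> (1 / a + 1 / b) * norm (G (z k) + B (z k))" for k
        using norm_scale_pair_le[of "1 / a" "1 / b" "G (z k) + B (z k)"] ab
        unfolding residual z by (simp add: scale_pair_def)
      from littleo[OF dominated[OF rates(3) norm_ge_zero this] t_pos]
      show "(\<lambda>k. norm (gradient f (x k) + transpose K *v y k, gradient g (y k) - K *v x k))
          \<in> o(\<lambda>k. 1 / t k)" .
    qed
    with w conv show ?thesis unfolding zeros by (intro bexI) auto
  qed
  ultimately show ?thesis ..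
qed

end
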